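(* For a finite solvable group $G$, let $d(G)$ denote the least number of system normalizers of $G$ whose intersection is the hypercenter $Z_\infty(G)$. Then: (1) For every odd prime power $q$, there is no integer $n$ such that $d(G)\le n$ for all finite metabelian groups $G$ with $|\Phi(G)|=q$. (2) Consequently, there is no integer $n$ such that $d(G)\le n$ for all finite solvable groups $G$, and there is no function $F:\mathbb{Z}_{\geq 1}\to\mathbb{Z}_{\geq 1}$ such that $d(G)\le F(|\Phi(G)|)$ for all finite solvable groups $G$.
   Context: A group is metabelian if its commutator subgroup is abelian. For a finite group $G$, $\Phi(G)$ is the Frattini subgroup (the intersection of all maximal subgroups of $G$). The upper central series is $Z_0(G)=1$, $Z_{i+1}(G)/Z_i(G)=Z(G/Z_i(G))$ for $i\ge 0$, where $Z(\cdot)$ denotes the center; for finite $G$ it stabilizes, and its final term is the hypercenter $Z_\infty(G)$. For a finite solvable group $G$ and a subset $\pi$ of the set of prime divisors of $|G|$, a Hall $\pi$-subgroup of $G$ is a subgroup whose order is divisible only by primes in $\pi$ and whose index is divisible only by primes outside $\pi$. A Hall system $\mathcal H$ of $G$ consists of one Hall $\pi$-subgroup for each subset $\pi$ of the set of prime divisors of $|G|$, such that every two members $K_1,K_2$ permute as subgroups ($K_1K_2=K_2K_1$). The system normalizer of $\mathcal H$ is $D(\mathcal H)=\bigcap_{K\in\mathcal H}\operatorname{N}_G(K)$, where $\operatorname{N}_G(K)=\{g\in G: g^{-1}Kg=K\}$. A system normalizer of $G$ is a subgroup of the form $D(\mathcal H)$ for some Hall system $\mathcal H$ of $G$. It is a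 known fact that the intersection of all system normalizers of a finite solvable group $G$ is $Z_\infty(G)$, so $d(G)$ is well defined. *)

theory Defs
  imports
    "HOL-Algebra.Solvable_Groups"
    "HOL-Algebra.Group_Action"
    "HOL-Number_Theory.Prime_Powers"
begin

definition metabelian :: "('a, 'b) monoid_scheme \<Rightarrow> bool" where
  "metabelian G \<longleftrightarrow> group G \<and> comm_group (G\<lparr>carrier := derived G (carrier G)\<rparr>)"

definition maximal_subgroup :: "'a set \<Rightarrow> ('a, 'b) monoid_scheme \<Rightarrow> bool" where
  "maximal_subgroup M G \<longleftrightarrow> subgroup M G \<and> M \<noteq> carrier G \<and>
     (\<forall>K. subgroup K G \<and> M \<subseteq> K \<longrightarrow> K = M \<or> K = carrier G)"

(* The intersection with the carrier matters only when there is no maximal subgroup,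
   in particular for the trivial group, which is then its own Frattini subgroup. *)
definition frattini :: "('a, 'b) monoid_scheme \<Rightarrow> 'a set" where
  "frattini G = carrier G \<inter> \<Inter>{M. maximal_subgroup M G}"

definition center :: "('a, 'b) monoid_scheme \<Rightarrow> 'a set" where
  "center G = {z \<in> carrier G. \<forall>x \<in> carrier G. z \<otimes>\<^bsub>G\<^esub> x = x \<otimes>\<^bsub>G\<^esub> z}"

primrec upper_central :: "('a, 'b) monoid_scheme \<Rightarrow> nat \<Rightarrow> 'a set" where
  "upper_central G 0 = {\<one>\<^bsub>G\<^esub>}"
| "upper_central G (Suc i) =
     {x \<in> carrier G. upper_central G i #>\<^bsub>G\<^esub> x \<in> center (G Mod upper_central G i)}"

(* For finite G this union is the final term of the series: see hypercenter_final below. *)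
definition hypercenter :: "('a, 'b) monoid_scheme \<Rightarrow> 'a set" where
  "hypercenter G = (\<Union>i. upper_central G i)"

definition hall_subgroup :: "('a, 'b) monoid_scheme \<Rightarrow> nat set \<Rightarrow> 'a set \<Rightarrow> bool" where
  "hall_subgroup G \<pi> K \<longleftrightarrow> subgroup K G \<and>
     (\<forall>p. prime p \<and> p dvd card K \<longrightarrow> p \<in> \<pi>) \<and>
     (\<forall>p. prime p \<and> p dvd card (rcosets\<^bsub>G\<^esub> K) \<longrightarrow> p \<notin> \<pi>)"

(* A Hall system is given as the family of its members, indexed by the sets of prime divisors
   of the order; values of the family at other index sets are irrelevant. *)
definition hall_system :: "('a, 'b) monoid_scheme \<Rightarrow> (nat set \<Rightarrow> 'a set) \<Rightarrow> bool" where
  "hall_system G \<H> \<longleftrightarrow>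
     (\<forall>\<pi> \<subseteq> prime_factors (order G). hall_subgroup G \<pi> (\<H> \<pi>)) \<and>
     (\<forall>\<pi> \<subseteq> prime_factors (order G). \<forall>\<rho> \<subseteq> prime_factors (order G).
        \<H> \<pi> <#>\<^bsub>G\<^esub> \<H> \<rho> = \<H> \<rho> <#>\<^bsub>G\<^esub> \<H> \<pi>)"

definition system_normalizer :: "('a, 'b) monoid_scheme \<Rightarrow> 'a set \<Rightarrow> bool" where
  "system_normalizer G D \<longleftrightarrow>
     (\<exists>\<H>. hall_system G \<H> \<and>
          D = (\<Inter>\<pi> \<in> Pow (prime_factors (order G)). normalizer G (\<H> \<pi>)))"

(* The invariant d(G). Meaningful for finite solvable G, where the system normalizers form a finite family with
   intersection the hypercenter, so that the set of admissible n is nonempty. *)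
definition least_sysnorms :: "('a, 'b) monoid_scheme \<Rightarrow> nat" where
  "least_sysnorms G = (LEAST n. \<exists>\<D>. finite \<D> \<and> \<D> \<noteq> {} \<and> card \<D> = n \<and>
            (\<forall>D \<in> \<D>. system_normalizer G D) \<and> \<Inter>\<D> = hypercenter G)"

lemma (in group) upper_central_normal: "upper_central G i \<lhd> G"
proof (induction i)
  case 0
  show ?case using one_is_normal by simp
next
  case (Suc i)
  let ?Z = "upper_central G i"
  interpret N: normal ?Z G by (rule Suc)
  have key: "x \<in> upper_central G (Suc i) \<longleftrightarrow>
      x \<in> carrier G \<and> (\<forall>y \<in> carrier G. ?Z #> (x \<otimes> y) = ?Z #> (y \<otimes> x))" for x
    by (auto simp: center_def FactGroup_def RCOSETS_def N.rcos_sum)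
  show ?case
  proof (rule normal_invI)
    show "subgroup (upper_central G (Suc i)) G"
    proof (rule subgroupI)
      show "upper_central G (Suc i) \<subseteq> carrier G" by auto
      have "\<one> \<in> upper_central G (Suc i)" unfolding key by simp
      then show "upper_central G (Suc i) \<noteq> {}" by blast
    next
      fix a assume a: "a \<in> upper_central G (Suc i)"
      then have ac: "a \<in> carrier G" by (simp add: key)
      show "inv a \<in> upper_central G (Suc i)"
        unfolding key
      proof (intro conjI ballI)
        show "inv a \<in> carrier G" using ac by simp
        fix y assume y: "y \<in> carrier G"
        let ?w = "inv a \<otimes> y \<otimes> inv a"
        have w: "?w \<in> carrier G" using ac y by simp
        have "?Z #> (a \<otimes> ?w) = ?Z #> (?w \<otimes> a)" using a w by (simp only: key)
        moreover have "a \<otimes> ?w = y \<otimes> inv a" using ac y by (simp add: m_assoc[symmetric])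
        moreover have "?w \<otimes> a = inv a \<otimes> y" using ac y by (simp add: m_assoc)
        ultimately show "?Z #> (inv a \<otimes> y) = ?Z #> (y \<otimes> inv a)" by simp
      qed
    next
      fix a b assume ab: "a \<in> upper_central G (Suc i)" "b \<in> upper_central G (Suc i)"
      then have c: "a \<in> carrier G" "b \<in> carrier G" by (simp_all add: key)
      show "a \<otimes> b \<in> upper_central G (Suc i)"
        unfolding key
      proof (intro conjI ballI)
        show "a \<otimes> b \<in> carrier G" using c by simp
        fix y assume y: "y \<in> carrier G"
        have "?Z #> (a \<otimes> b \<otimes> y) = ?Z #> (a \<otimes> (b \<otimes> y))" using c y by (simp add: m_assoc)
        also have "\<dots> = ?Z #> (b \<otimes> y \<otimes> a)" using ab(1) c y by (simp only: key) simp
        also have "\<dots> = ?Z #> (b \<otimes> (y \<otimes> a))" using c y by (simp add: m_assoc)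
        also have "\<dots> = ?Z #> (y \<otimes> a \<otimes> b)" using ab(2) c y by (simp only: key) simp
        also have "\<dots> = ?Z #> (y \<otimes> (a \<otimes> b))" using c y by (simp add: m_assoc)
        finally show "?Z #> (a \<otimes> b \<otimes> y) = ?Z #> (y \<otimes> (a \<otimes> b))" .
      qed
    qed
  next
    fix x h assume x: "x \<in> carrier G" and h: "h \<in> upper_central G (Suc i)"
    then have hc: "h \<in> carrier G" by (simp add: key)
    have eq: "?Z #> (x \<otimes> h \<otimes> inv x) = ?Z #> h"
    proof -
      have "?Z #> (x \<otimes> h \<otimes> inv x) = ?Z #> (x \<otimes> h) #> inv x"
        using x hc by (simp add: coset_mult_assoc N.subset)
      also have "?Z #> (x \<otimes> h) = ?Z #> (h \<otimes> x)" using h x by (simp only: key)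
      also have "?Z #> (h \<otimes> x) #> inv x = ?Z #> (h \<otimes> x \<otimes> inv x)"
        using x hc by (simp add: coset_mult_assoc N.subset)
      also have "h \<otimes> x \<otimes> inv x = h" using x hc by (simp add: m_assoc)
      finally show ?thesis .
    qed
    show "x \<otimes> h \<otimes> inv x \<in> upper_central G (Suc i)"
      using h x hc eq by simp
  qed
qed

lemma (in group) upper_central_mono: "upper_central G i \<subseteq> upper_central G (Suc i)"
proof
  interpret N: normal "upper_central G i" G by (rule upper_central_normal)
  fix x assume x: "x \<in> upper_central G i"
  have xc: "x \<in> carrier G" using x N.subset by blast
  have "upper_central G i #> x = upper_central G i"
    using x by (rule N.rcos_const[OF is_group])
  moreover have "upper_central G i \<in> center (G Mod upper_central G i)"
  proof -
    interpret Q: group "G Mod upper_central G i" by (rule N.factorgroup_is_group)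
    have "\<one>\<^bsub>G Mod upper_central G i\<^esub> \<in> center (G Mod upper_central G i)"
      unfolding center_def
      by (intro CollectI conjI ballI) (simp_all only: Q.one_closed Q.l_one Q.r_one)
    then show ?thesis by (simp add: FactGroup_def)
  qed
  ultimately show "x \<in> upper_central G (Suc i)" using xc by simp
qed

lemma (in group) hypercenter_final:
  assumes "finite (carrier G)"
  shows "\<exists>n. \<forall>m\<ge>n. upper_central G m = hypercenter G"
proof -
  have mono: "upper_central G i \<subseteq> upper_central G j" if "i \<le> j" for i j
    using that by (rule lift_Suc_mono_le[of "upper_central G", OF upper_central_mono])
  have sub: "upper_central G i \<subseteq> carrier G" for i
    using normal_imp_subgroup[OF upper_central_normal] subgroup.subset by blast
  have "finite (range (upper_central G))"
    by (rule finite_subset[of _ "Pow (carrier G)"]) (use assms sub in auto)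
  then obtain n where n: "\<And>m. upper_central G m \<subseteq> upper_central G n"
  proof -
    assume fin: "finite (range (upper_central G))"
      and thesis: "\<And>n. (\<And>m. upper_central G m \<subseteq> upper_central G n) \<Longrightarrow> thesis"
    obtain X where X: "X \<in> range (upper_central G)"
      and max: "\<And>Y. Y \<in> range (upper_central G) \<Longrightarrow> X \<subseteq> Y \<Longrightarrow> X = Y"
      using finite_has_maximal[OF fin] by auto
    obtain n where Xn: "X = upper_central G n" using X by auto
    have "upper_central G m \<subseteq> upper_central G n" for m
    proof -
      have "X = upper_central G (m + n)"
        using max[of "upper_central G (m + n)"] mono[of n "m + n"] Xn by simp
      then show ?thesis using mono[of m "m + n"] Xn by simp
    qed
    then show thesis by (rule thesis)
  qed
  have "upper_central G m = hypercenter G" if "n \<le> m" for m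
    unfolding hypercenter_def using n mono[OF that] by blast
  then show ?thesis by blast
qed

end

theory Submission
  imports Defs "HOL-Algebra.Zassenhaus" "HOL-Number_Theory.Cong"
begin

text \<open>Let p be an odd prime, q = p^k with k \<ge> 1, and m arbitrary. The group that shows d(G) \<ge> m is the
semidirect product G = BT of abelian groups B = W \<oplus> Z and T = C \<times> {1, -1}, where
W = C = (\<int>/p)^m and Z = \<int>/p^(k+1). The sign -1 acts on B by inversion, and c \<in> C acts by
(w, z) \<mapsto> (w, z + p^k \<langle>c, w\<rangle>). Since B and T are abelian, G is metabelian.

The Frattini subgroup is pZ, of order q, whatever m is. On the one hand, every other element is
excluded by a coordinate: the sign, each entry of c, each entry of w, and z modulo p are crossed homomorphisms
onto a cyclic group of prime order, and the zero set of such a map is a maximal subgroup. On the other hand,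
a maximal subgroup that does not contain the normal subgroup pZ supplements it. Writing \<zeta> for a generator
of Z, it then contains some \<zeta>^(1 - pj), which also generates Z, a contradiction.

The subgroup P = BC is a p-group of index two. Therefore the only member of a Hall system that can fail to be
normal is the Sylow 2-subgroup, which is generated by an involution, and the system normalizers are exactly the
centralizers of the involutions. The involutions are the elements b\<tau> with b \<in> B and \<tau> = -1 in T.
Only the identity commutes with all of them, so the centre and the hypercenter are trivial, and the
intersection of all system normalizers is the hypercenter. An element c \<in> C commutes with b\<tau>, for
b = (w, z), as soon as \<langle>c, w\<rangle> = 0 in \<int>/p. Fewer than m involutions impose fewer than m
conditions with values in \<int>/p, so by the pigeonhole principle they have a common solution c \<noteq> 0, and the
intersection of the corresponding system normalizers is not trivial. Hence d(G) \<ge> m, while the order of the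
Frattini subgroup is q.

Passing to an isomorphic copy makes the carrier a set of natural numbers. The statements about solvable groups
follow from the case q = 3.\<close>

section \<open>System normalizers in groups with a Sylow subgroup of index two\<close>

definition centralizer :: "('a, 'b) monoid_scheme \<Rightarrow> 'a \<Rightarrow> 'a set" where
  "centralizer G t = {g \<in> carrier G. g \<otimes>\<^bsub>G\<^esub> t = t \<otimes>\<^bsub>G\<^esub> g}"

definition involutions :: "('a, 'b) monoid_scheme \<Rightarrow> 'a set" where
  "involutions G = {t \<in> carrier G. t \<noteq> \<one>\<^bsub>G\<^esub> \<and> t \<otimes>\<^bsub>G\<^esub> t = \<one>\<^bsub>G\<^esub>}"

context group
begin

lemma index_two_mult:
  assumes H: "subgroup H G" and idx: "card (rcosets H) = 2"
    and x: "x \<in> carrier G" "x \<notin> H" and y: "y \<in> carrier G" "y \<notin> H"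
  shows "x \<otimes> y \<in> H"
proof -
  let ?y = "inv y"
  have iy: "?y \<in> carrier G" "?y \<notin> H"
    using y subgroup.m_inv_closed[OF H, of "inv y"] by auto
  have mem: "H \<in> rcosets H" "H #> ?y \<in> rcosets H" "H #> x \<in> rcosets H"
    using subgroup.subset[OF H] iy x rcosetsI coset_mult_one[of H] one_closed by metis+
  have "H \<noteq> H #> ?y" "H \<noteq> H #> x"
    using rcos_self[OF _ H] iy x by blast+
  moreover obtain U V where "rcosets H = {U, V}"
    using idx by (auto simp: card_2_iff)
  ultimately have "H #> ?y = H #> x" using mem by auto
  then have "x \<in> H #> ?y" using rcos_self[OF x(1) H] by simp
  then obtain h where h: "h \<in> H" "x = h \<otimes> ?y" by (auto simp: r_coset_def)
  then have "x \<otimes> y = h" using subgroup.mem_carrier[OF H h(1)] y by (simp add: m_assoc)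
  then show ?thesis using h by simp
qed

lemma index_two_normal:
  assumes H: "subgroup H G" and idx: "card (rcosets H) = 2"
  shows "H \<lhd> G"
proof (rule normal_invI[OF H])
  fix x h assume x: "x \<in> carrier G" and h: "h \<in> H"
  have hc: "h \<in> carrier G" using subgroup.mem_carrier[OF H h] .
  show "x \<otimes> h \<otimes> inv x \<in> H"
  proof (cases "x \<in> H")
    case True
    then show ?thesis using h H by (simp add: subgroup.m_closed subgroup.m_inv_closed)
  next
    case False
    have "x \<otimes> h \<notin> H"
    proof
      assume "x \<otimes> h \<in> H"
      then have "x \<otimes> h \<otimes> inv h \<in> H" using h H by (simp add: subgroup.m_closed subgroup.m_inv_closed)
      then show False using False x hc by (simp add: m_assoc)
    qed
    moreover have "inv x \<notin> H"
      using False x subgroup.m_inv_closed[OF H, of "inv x"] by auto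
    ultimately show ?thesis using index_two_mult[OF H idx] x hc by simp
  qed
qed

lemma normalizer_eq:
  assumes "H \<subseteq> carrier G"
  shows "normalizer G H = {g \<in> carrier G. (g <# H) #> inv g = H}"
  using assms by (simp add: normalizer_def stabilizer_def)

lemma normalizer_of_normal:
  assumes "N \<lhd> G"
  shows "normalizer G N = carrier G"
proof -
  interpret N: normal N G by fact
  have "(g <# N) #> inv g = N" if g: "g \<in> carrier G" for g
    using g N.coset_eq N.subset by (metis coset_mult_assoc coset_mult_one inv_closed r_inv)
  then show ?thesis using N.subset by (auto simp: normalizer_eq)
qed

lemma normalizer_involution:
  assumes "t \<in> involutions G"
  shows "normalizer G {\<one>, t} = centralizer G t"
proof -
  have t: "t \<in> carrier G" "t \<noteq> \<one>" using assms by (auto simp: involutions_def)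
  have "(g <# {\<one>, t}) #> inv g = {\<one>, t} \<longleftrightarrow> g \<otimes> t = t \<otimes> g" if g: "g \<in> carrier G" for g
  proof -
    have 1: "(g <# {\<one>, t}) #> inv g = {\<one>, g \<otimes> t \<otimes> inv g}"
      using g by (auto simp: l_coset_def r_coset_def)
    have 2: "g \<otimes> t \<otimes> inv g = t \<longleftrightarrow> g \<otimes> t = t \<otimes> g"
      using g t by (simp add: inv_solve_right')
    have 3: "g \<otimes> t \<otimes> inv g \<noteq> \<one>"
      using g t by (simp add: inv_solve_right')
    show ?thesis using 1 2 3 t by (auto simp: doubleton_eq_iff)
  qed
  then show ?thesis using t by (auto simp: normalizer_eq centralizer_def)
qed

lemma subgroup_involution:
  assumes "t \<in> involutions G"
  shows "subgroup {\<one>, t} G"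
  using assms by (intro subgroupI) (auto simp: involutions_def inv_equality)

lemma subgroup_card_two:
  assumes "subgroup K G" "card K = 2"
  obtains t where "t \<in> involutions G" "K = {\<one>, t}"
proof -
  have "\<one> \<in> K" using assms subgroup.one_closed by blast
  then obtain t where t: "K = {\<one>, t}" "t \<noteq> \<one>" using assms(2) by (auto simp: card_2_iff)
  then have tc: "t \<in> carrier G" using subgroup.subset[OF assms(1)] by blast
  have "t \<otimes> t \<in> K" using subgroup.m_closed[OF assms(1)] t by blast
  moreover have "t \<otimes> t \<noteq> t" using t tc by simp
  ultimately have "t \<otimes> t = \<one>" using t by blast
  then show thesis using that t tc by (auto simp: involutions_def)
qed

end

lemma eq_one_if_no_prime_divisor:
  assumes "a * b \<noteq> (0::nat)" "\<And>p. prime p \<Longrightarrow> p dvd a \<Longrightarrow> False"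
  shows "a = 1"
  using assms prime_factor_nat by blast

text \<open>Applied to the product of the order and the index of a Hall subgroup.\<close>

lemma coprime_parts_unique:
  fixes a b r P :: nat
  assumes "a * b = r * P" "coprime a P" "coprime b r"
  shows "a = r"
proof (rule dvd_antisym)
  show "a dvd r" using assms(1,2) by (metis coprime_dvd_mult_left_iff dvd_triv_left)
  show "r dvd a" using assms(1,3) by (metis coprime_commute coprime_dvd_mult_left_iff dvd_triv_left)
qed

text \<open>The order of the group has only the prime divisors 2 and p, so a Hall system has four members. Three of them are normal, and only the one of
order two can have a proper normalizer.\<close>

locale index_two_sylow = group +
  fixes P :: "'a set" and p N :: nat
  assumes P: "subgroup P G" and p: "prime p" "odd p" and N: "N > 0"
    and card_P: "card P = p ^ N" and order_G: "order G = 2 * p ^ N"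
begin

lemma p_neq_2: "p \<noteq> 2"
  using p by auto

lemma finite_carrier: "finite (carrier G)"
  using order_G p by (metis card.infinite order_def mult_eq_0_iff not_prime_0 power_not_zero zero_neq_numeral)

lemma primes_order: "prime_factors (order G) = {2, p}"
  using p N two_is_prime_nat
  by (auto simp: order_G prime_factors_product prime_factorization_prime_power
      prime_factorization_prime[OF two_is_prime_nat])

lemma prime_dvd_order: "prime r \<Longrightarrow> r dvd order G \<Longrightarrow> r = 2 \<or> r = p"
  using p two_is_prime_nat
  by (metis order_G prime_dvd_mult_nat prime_dvd_power primes_dvd_imp_eq)

lemma index_mult: "subgroup K G \<Longrightarrow> card (rcosets K) * card K = 2 * p ^ N"
  using lagrange order_G by simp

lemma index_two_imp_normal:
  assumes "subgroup K G" "card K = p ^ N"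
  shows "K \<lhd> G"
  using index_two_normal[OF assms(1)] index_mult[OF assms(1)] assms p by simp

lemma hall_two:
  assumes "hall_subgroup G {2} K"
  shows "card K = 2"
proof -
  have K: "subgroup K G" using assms by (simp add: hall_subgroup_def)
  have "\<not> p dvd card K"
    using assms p p_neq_2 by (auto simp: hall_subgroup_def)
  moreover have "\<not> 2 dvd card (rcosets K)"
    using assms two_is_prime_nat unfolding hall_subgroup_def by blast
  ultimately have "coprime (card K) (p ^ N)" "coprime (card (rcosets K)) 2"
    using p(1) two_is_prime_nat by (simp_all add: prime_imp_coprime coprime_commute)
  then show ?thesis
    using coprime_parts_unique[of "card K" "card (rcosets K)" 2 "p ^ N"] index_mult[OF K]
    by (simp add: mult.commute)
qed

lemma hall_p:
  assumes "hall_subgroup G {p} K"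
  shows "card K = p ^ N"
proof -
  have K: "subgroup K G" using assms by (simp add: hall_subgroup_def)
  have "\<not> 2 dvd card K"
    using assms p_neq_2 two_is_prime_nat unfolding hall_subgroup_def by blast
  moreover have "\<not> p dvd card (rcosets K)"
    using assms p by (auto simp: hall_subgroup_def)
  ultimately have "coprime (card K) 2" "coprime (card (rcosets K)) (p ^ N)"
    using p(1) two_is_prime_nat by (simp_all add: prime_imp_coprime coprime_commute)
  then show ?thesis
    using coprime_parts_unique[of "card K" "card (rcosets K)" "p ^ N" 2] index_mult[OF K]
    by (simp add: mult.commute)
qed

lemma hall_full:
  assumes "hall_subgroup G {2, p} K"
  shows "K = carrier G"
proof -
  have K: "subgroup K G" using assms by (simp add: hall_subgroup_def)
  have "card (rcosets K) = 1"
  proof (rule eq_one_if_no_prime_divisor)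
    show "card (rcosets K) * card K \<noteq> 0" using index_mult[OF K] p by simp
    show False if "prime r" "r dvd card (rcosets K)" for r
    proof -
      have "r dvd order G" using that lagrange[OF K] by (metis dvd_triv_left dvd_trans)
      then show False using prime_dvd_order that assms by (auto simp: hall_subgroup_def)
    qed
  qed
  then have "card K = card (carrier G)" using lagrange[OF K] by (simp add: order_def)
  then show ?thesis using card_subset_eq[OF finite_carrier subgroup.subset[OF K]] by simp
qed

lemma hall_empty:
  assumes "hall_subgroup G {} K"
  shows "K = {\<one>}"
proof -
  have K: "subgroup K G" using assms by (simp add: hall_subgroup_def)
  have "card K = 1"
  proof (rule eq_one_if_no_prime_divisor)
    show "card K * card (rcosets K) \<noteq> 0" using index_mult[OF K] p by (simp add: mult.commute)
  qed (use assms in \<open>auto simp: hall_subgroup_def\<close>)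
  then show ?thesis using subgroup.one_closed[OF K] by (auto simp: card_1_singleton_iff)
qed

lemma Pow_primes: "Pow (prime_factors (order G)) = {{}, {2}, {p}, {2, p}}"
  using primes_order by (auto simp: Pow_insert)

text \<open>A Hall system consists of the trivial group, the whole group, a subgroup of index two, and a subgroup
{1, t} of order two. All but the last are normal, so the system normalizer is the centralizer of t.
For the converse, t can be any involution: the four subgroups permute because at most one is not normal.\<close>

lemma system_normalizer_iff:
  "system_normalizer G D \<longleftrightarrow> (\<exists>t \<in> involutions G. D = centralizer G t)"
proof
  assume "system_normalizer G D"
  then obtain H where sys: "hall_system G H"
    and D: "D = (\<Inter>\<pi> \<in> Pow (prime_factors (order G)). normalizer G (H \<pi>))"
    unfolding system_normalizer_def by (elim exE conjE)
  have H: "hall_subgroup G \<pi> (H \<pi>)" if "\<pi> \<in> {{}, {2}, {p}, {2, p}}" for \<pi>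
    using sys that unfolding hall_system_def Pow_primes[symmetric] Pow_iff by (elim conjE) simp
  have sub: "subgroup (H \<pi>) G" if "\<pi> \<in> {{}, {2}, {p}, {2, p}}" for \<pi>
    using H[OF that] by (simp add: hall_subgroup_def)
  obtain t where t: "t \<in> involutions G" "H {2} = {\<one>, t}"
    using subgroup_card_two[OF sub hall_two[OF H]] by auto
  have "H {p} \<lhd> G"
    using index_two_imp_normal[OF sub hall_p[OF H]] by simp
  moreover have "H {} = {\<one>}" "H {2, p} = carrier G"
    using hall_empty[OF H] hall_full[OF H] by simp_all
  ultimately have "D = centralizer G t"
    unfolding D Pow_primes using t
    by (auto simp: normalizer_of_normal one_is_normal normal_self normalizer_involution centralizer_def)
  then show "\<exists>t \<in> involutions G. D = centralizer G t" using t by blast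
next
  assume "\<exists>t \<in> involutions G. D = centralizer G t"
  then obtain t where t: "t \<in> involutions G" "D = centralizer G t" by blast
  define H where "H \<pi> = (if 2 \<in> \<pi> then if p \<in> \<pi> then carrier G else {\<one>, t}
    else if p \<in> \<pi> then P else {\<one>})" for \<pi> :: "nat set"
  have vals: "H {} = {\<one>}" "H {2} = {\<one>, t}" "H {p} = P" "H {2, p} = carrier G"
    using p_neq_2 by (simp_all add: H_def)
  have sub: "subgroup {\<one>, t} G" using subgroup_involution[OF t(1)] .
  have normal: "{\<one>} \<lhd> G" "P \<lhd> G" "carrier G \<lhd> G"
    using index_two_imp_normal[OF P card_P] by (simp_all add: one_is_normal normal_self)
  have sub_all: "subgroup (H \<pi>) G" if "\<pi> \<in> {{}, {2}, {p}, {2, p}}" for \<pi>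
    using that vals sub normal normal_imp_subgroup by auto
  have permute: "H \<pi> <#> H \<rho> = H \<rho> <#> H \<pi>"
    if "\<pi> \<in> {{}, {2}, {p}, {2, p}}" "\<rho> \<in> {{}, {2}, {p}, {2, p}}" for \<pi> \<rho>
  proof -
    have "H \<pi> \<lhd> G \<or> H \<pi> = {\<one>, t}" "H \<rho> \<lhd> G \<or> H \<rho> = {\<one>, t}"
      using that vals normal by auto
    then show ?thesis
      using commut_normal[OF sub_all[OF that(1)], of "H \<rho>"]
        commut_normal[OF sub_all[OF that(2)], of "H \<pi>"] by metis
  qed
  have idx: "card (rcosets (H \<pi>)) * card (H \<pi>) = 2 * p ^ N" if "\<pi> \<in> {{}, {2}, {p}, {2, p}}" for \<pi>
    using index_mult[OF sub_all[OF that]] .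
  have card_t: "card {\<one>, t} = 2" using t by (auto simp: involutions_def)
  have pp: "r = p" if "prime r" "r dvd p ^ N" for r
    using that p by (metis prime_dvd_power primes_dvd_imp_eq)
  have p0: "p ^ N > 0" using p by (simp add: prime_gt_0_nat)
  have "hall_subgroup G {} (H {})"
    using sub_all[of "{}"] not_prime_1 by (auto simp: hall_subgroup_def vals)
  moreover have "hall_subgroup G {2} (H {2})"
  proof -
    have "card (rcosets (H {2})) = p ^ N" using idx[of "{2}"] vals card_t by simp
    then show ?thesis using sub_all[of "{2}"] p_neq_2 pp
      unfolding hall_subgroup_def vals card_t by (auto simp: primes_dvd_imp_eq two_is_prime_nat)
  qed
  moreover have "hall_subgroup G {p} (H {p})"
  proof -
    have "card (rcosets (H {p})) = 2" using idx[of "{p}"] vals card_P prime_gt_0_nat[OF p(1)] by simp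
    then show ?thesis using sub_all[of "{p}"] p_neq_2 pp
      unfolding hall_subgroup_def vals card_P by (auto simp: primes_dvd_imp_eq two_is_prime_nat)
  qed
  moreover have "hall_subgroup G {2, p} (H {2, p})"
  proof -
    have "card (rcosets (H {2, p})) = 1"
      using idx[of "{2, p}"] order_G prime_gt_0_nat[OF p(1)] by (simp add: vals order_def)
    moreover have "r \<in> {2, p}" if "prime r" "r dvd card (H {2, p})" for r
      using prime_dvd_order that by (simp add: vals order_def)
    ultimately show ?thesis using sub_all[of "{2, p}"] not_prime_1
      unfolding hall_subgroup_def by (metis insertCI nat_dvd_1_iff_1)
  qed
  ultimately have "hall_subgroup G \<pi> (H \<pi>)" if "\<pi> \<subseteq> prime_factors (order G)" for \<pi>
    using that unfolding Pow_iff[symmetric] Pow_primes by fastforce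
  then have "hall_system G H"
    using permute unfolding hall_system_def Pow_primes[symmetric] Pow_iff by simp
  moreover have "D = (\<Inter>\<pi> \<in> Pow (prime_factors (order G)). normalizer G (H \<pi>))"
    unfolding t(2) Pow_primes using normal
    by (auto simp: vals normalizer_of_normal normalizer_involution[OF t(1)] centralizer_def)
  ultimately show "system_normalizer G D" unfolding system_normalizer_def by blast
qed

end

lemma (in group) hypercenter_trivial:
  assumes "center G = {\<one>}"
  shows "hypercenter G = {\<one>}"
proof -
  have "upper_central G i = {\<one>}" for i
  proof (induction i)
    case (Suc i)
    have coset: "{\<one>} #> x = {x}" if "x \<in> carrier G" for x
      using that by (auto simp: r_coset_def)
    have "{\<one>} #> x \<in> center (G Mod {\<one>}) \<longleftrightarrow> x \<in> center G" if x: "x \<in> carrier G" for x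
    proof -
      have "carrier (G Mod {\<one>}) = (\<lambda>y. {y}) ` carrier G"
        using coset by (auto simp: FactGroup_def RCOSETS_def)
      moreover have "{x} <#> {y} = {x \<otimes> y}" for x y
        by (auto simp: set_mult_def)
      ultimately show ?thesis
        using x unfolding coset[OF x] by (auto simp: center_def FactGroup_def)
    qed
    then have "upper_central G (Suc i) = {x \<in> carrier G. x \<in> center G}"
      using Suc by (simp cong: conj_cong)
    then show ?case using assms by auto
  qed simp
  then show ?thesis by (simp add: hypercenter_def)
qed

context index_two_sylow
begin

text \<open>Both hypotheses serve the lower bound. The first makes the hypercenter trivial and shows that the
family of all system normalizers has this intersection, so that the least number is attained by some family.
The second excludes every family with fewer than m members.\<close>

lemma least_sysnorms_ge:
  assumes centerless: "\<And>x. x \<in> carrier G \<Longrightarrow> (\<And>t. t \<in> involutions G \<Longrightarrow> x \<otimes> t = t \<otimes> x) \<Longrightarrow> x = \<one>"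
    and common: "\<And>S. S \<subseteq> involutions G \<Longrightarrow> card S < m \<Longrightarrow>
      \<exists>x \<in> carrier G. x \<noteq> \<one> \<and> (\<forall>t \<in> S. x \<otimes> t = t \<otimes> x)"
  shows "m \<le> least_sysnorms G"
proof (rule ccontr)
  assume "\<not> m \<le> least_sysnorms G"
  have hyper: "hypercenter G = {\<one>}"
    using centerless by (intro hypercenter_trivial) (auto simp: center_def involutions_def)
  let ?P = "\<lambda>n. \<exists>\<D>. finite \<D> \<and> \<D> \<noteq> {} \<and> card \<D> = n \<and>
            (\<forall>D \<in> \<D>. system_normalizer G D) \<and> \<Inter>\<D> = hypercenter G"
  have "?P (card (centralizer G ` involutions G))"
  proof (intro exI conjI ballI)
    show "finite (centralizer G ` involutions G)"
      using finite_carrier by (simp add: involutions_def)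
    have "involutions G \<noteq> {}"
    proof
      assume "involutions G = {}"
      then have "carrier G \<subseteq> {\<one>}" using centerless by blast
      then have "order G \<le> 1" using card_mono[of "{\<one>}" "carrier G"] by (simp add: order_def)
      moreover have "p ^ N > 0" using p by (simp add: prime_gt_0_nat)
      ultimately show False using order_G by simp
    qed
    then show "centralizer G ` involutions G \<noteq> {}" by simp
    show "\<Inter>(centralizer G ` involutions G) = hypercenter G"
      unfolding hyper using centerless \<open>involutions G \<noteq> {}\<close>
      by (auto simp: centralizer_def involutions_def)
  qed (auto simp: system_normalizer_iff)
  then have "?P (least_sysnorms G)" unfolding least_sysnorms_def by (rule LeastI)
  then obtain \<D> where D: "finite \<D>" "\<D> \<noteq> {}" "card \<D> = least_sysnorms G"
    "\<forall>D \<in> \<D>. \<exists>t \<in> involutions G. D = centralizer G t" "\<Inter>\<D> = {\<one>}"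
    unfolding system_normalizer_iff hyper by blast
  then obtain t where t: "\<And>D. D \<in> \<D> \<Longrightarrow> t D \<in> involutions G \<and> D = centralizer G (t D)" by metis
  have "card (t ` \<D>) < m"
    using card_image_le[OF D(1), of t] D(3) \<open>\<not> m \<le> least_sysnorms G\<close> by simp
  then obtain x where x: "x \<in> carrier G" "x \<noteq> \<one>" "\<forall>D \<in> \<D>. x \<otimes> t D = t D \<otimes> x"
    using common[of "t ` \<D>"] t by auto
  then have "x \<in> D" if "D \<in> \<D>" for D
    using t[OF that] that unfolding centralizer_def by blast
  then have "x \<in> \<Inter>\<D>" by blast
  then show False unfolding D(5) using x(2) by simp
qed

end

section \<open>Maximal subgroups and the Frattini subgroup\<close>

context group
begin

text \<open>Every coset of M contains a power of u. A strictly larger subgroup therefore contains a power u^j outside M. As u^r \<in> M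
and r is prime, j is coprime to r, so u itself lies in the larger subgroup, which is then everything.\<close>

lemma maximal_subgroup_if_prime_power_transversal:
  assumes M: "subgroup M G" and r: "prime (r::int)"
    and u: "u \<in> carrier G" "u \<notin> M" "u [^] r \<in> M"
    and cover: "\<And>g. g \<in> carrier G \<Longrightarrow> \<exists>j::int. g \<otimes> u [^] j \<in> M"
  shows "maximal_subgroup M G"
proof -
  have "K = carrier G" if K: "subgroup K G" "M \<subseteq> K" "K \<noteq> M" for K
  proof -
    note K_closed = subgroup.m_closed[OF K(1)] subgroup.m_inv_closed[OF K(1)]
      subgroup.mem_carrier[OF K(1)] subgroup_int_pow_closed[OF K(1)]
    have strip: "g \<in> K" if "g \<otimes> h \<in> K" "h \<in> K" "g \<in> carrier G" for g h
    proof -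
      have "g = g \<otimes> h \<otimes> inv h" using that K_closed by (simp add: m_assoc)
      then show ?thesis using that K_closed by metis
    qed
    have "\<not> K \<subseteq> M" using K(2,3) by simp
    then obtain g where g: "g \<in> K" "g \<notin> M" by (auto simp: subset_iff)
    then obtain j :: int where j: "g \<otimes> u [^] j \<in> M" using cover[OF K_closed(3)] by auto
    have uj: "u [^] j \<in> K"
    proof -
      have "u [^] j = inv g \<otimes> (g \<otimes> u [^] j)"
        using g(1) u K_closed by (simp add: m_assoc[symmetric])
      then show ?thesis using K_closed(1)[OF K_closed(2)[OF g(1)] subsetD[OF K(2) j]] by simp
    qed
    have "\<not> r dvd j"
    proof
      assume "r dvd j"
      then obtain i where "j = r * i" by (auto simp: dvd_def)
      then have "u [^] j \<in> M" using subgroup_int_pow_closed[OF M u(3), of i] u(1) by (simp add: int_pow_pow)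
      then have "g \<otimes> u [^] j \<otimes> inv (u [^] j) \<in> M"
        using j M by (simp add: subgroup.m_closed subgroup.m_inv_closed)
      then show False using g K_closed(3)[OF g(1)] u(1) by (simp add: m_assoc)
    qed
    then have "coprime r j" using r prime_imp_coprime by blast
    then obtain a b where ab: "a * r + b * j = 1" using bezout_int[of r j] by auto
    have "u = u [^] (a * r + b * j)" using ab u by simp
    also have "\<dots> = (u [^] r) [^] a \<otimes> (u [^] j) [^] b"
      using u by (simp add: int_pow_mult int_pow_pow mult.commute)
    finally have uK: "u \<in> K"
      using K_closed(1)[OF K_closed(4)[OF subsetD[OF K(2) u(3)], of a] K_closed(4)[OF uj, of b]] by simp
    have "g \<in> K" if g: "g \<in> carrier G" for g
    proof -
      obtain j :: int where "g \<otimes> u [^] j \<in> M" using cover[OF g] by blast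
      then show ?thesis using strip[OF subsetD[OF K(2)] K_closed(4)[OF uK] g] by simp
    qed
    then show ?thesis using subgroup.subset[OF K(1)] by blast
  qed
  then show ?thesis using M u by (auto simp: maximal_subgroup_def)
qed

text \<open>If a maximal subgroup M does not contain N, then NM is the whole group, and y = y^(rj) m with m \<in> M. Then
m = y^(1 - rj) generates the same cyclic group as y, because 1 - rj is coprime to the order of y; so M contains
y, and with it N, after all.\<close>

lemma normal_subset_frattini:
  assumes N: "N \<lhd> G" and y: "y \<in> carrier G" and ord: "y [^] (r ^ e :: int) = \<one>"
    and powers: "\<And>x. x \<in> N \<Longrightarrow> \<exists>j::int. x = y [^] (r * j)"
  shows "N \<subseteq> frattini G"
proof -
  have NG: "N \<subseteq> carrier G" using N normal_imp_subgroup subgroup.subset by blast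
  have "N \<subseteq> M" if max: "maximal_subgroup M G" for M
  proof (rule ccontr)
    assume not: "\<not> N \<subseteq> M"
    have M: "subgroup M G" using max by (simp add: maximal_subgroup_def)
    have "subgroup (N <#> M) G" using mult_norm_subgroup[OF N M] .
    moreover have "M \<subseteq> N <#> M"
    proof
      fix x assume x: "x \<in> M"
      have "\<one> \<in> N" using N normal_imp_subgroup subgroup.one_closed by blast
      then have "\<one> \<otimes> x \<in> N <#> M" using x unfolding set_mult_def by blast
      then show "x \<in> N <#> M" using x subgroup.mem_carrier[OF M] by simp
    qed
    moreover have "N \<subseteq> N <#> M"
    proof
      fix x assume x: "x \<in> N"
      have "x \<otimes> \<one> \<in> N <#> M" using x subgroup.one_closed[OF M] unfolding set_mult_def by blast
      then show "x \<in> N <#> M" using x NG by auto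
    qed
    ultimately have "N <#> M = carrier G" using max not unfolding maximal_subgroup_def by metis
    then obtain x m where xm: "x \<in> N" "m \<in> M" "y = x \<otimes> m" using y unfolding set_mult_def by blast
    obtain j :: int where j: "x = y [^] (r * j)" using powers xm(1) by blast
    have mc: "m \<in> carrier G" using subgroup.mem_carrier[OF M xm(2)] .
    have m: "m = y [^] (1 - r * j)"
    proof -
      have "m = inv x \<otimes> y" using xm mc NG by (simp add: m_assoc[symmetric] subsetD)
      also have "\<dots> = y [^] (- (r * j)) \<otimes> y [^] (1::int)" using y j by (simp add: int_pow_neg)
      also have "\<dots> = y [^] (- (r * j) + 1)" by (rule int_pow_mult[OF y, symmetric])
      finally show ?thesis by simp
    qed
    have "coprime (1 - r * j) (r ^ e)"
    proof -
      have "coprime (1 - r * j) r"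
      proof (rule coprimeI)
        fix c assume "c dvd 1 - r * j" "c dvd r"
        then have "c dvd (1 - r * j) + r * j" by (intro dvd_add dvd_mult2)
        then show "is_unit c" by simp
      qed
      then show ?thesis by simp
    qed
    then obtain a b where ab: "a * (1 - r * j) + b * r ^ e = 1"
      using bezout_int[of "1 - r * j" "r ^ e"] by auto
    have "y = y [^] (a * (1 - r * j) + b * r ^ e)" using ab y by simp
    also have "\<dots> = (y [^] (1 - r * j)) [^] a \<otimes> (y [^] (r ^ e)) [^] b"
      using y by (simp add: int_pow_mult int_pow_pow mult.commute)
    also have "\<dots> = m [^] a" using ord m mc by simp
    finally have "y \<in> M" using subgroup_int_pow_closed[OF M xm(2)] by metis
    then show False using not powers subgroup_int_pow_closed[OF M] by blast
  qed
  then show ?thesis using NG by (auto simp: frattini_def)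
qed

end

text \<open>A coordinate modulo r on which the group acts by signs is a crossed homomorphism to \<int>/r. Its zero set is in general
not normal, but it is still a subgroup, and the powers of an element u of value 1 represent its cosets.\<close>

lemma (in group) maximal_subgroup_crossed_hom:
  fixes f \<epsilon> :: "'a \<Rightarrow> int"
  assumes r: "prime r"
    and sign: "\<And>x. x \<in> carrier G \<Longrightarrow> \<epsilon> x = 1 \<or> \<epsilon> x = -1"
    and crossed: "\<And>x y. x \<in> carrier G \<Longrightarrow> y \<in> carrier G \<Longrightarrow> [f (x \<otimes> y) = f x + \<epsilon> x * f y] (mod r)"
    and u: "u \<in> carrier G" "[f u = 1] (mod r)" "\<epsilon> u = 1"
  shows "maximal_subgroup {x \<in> carrier G. r dvd f x} G"
proof -
  let ?M = "{x \<in> carrier G. r dvd f x}"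
  have iff: "r dvd f (x \<otimes> y) \<longleftrightarrow> r dvd f x + \<epsilon> x * f y" if "x \<in> carrier G" "y \<in> carrier G" for x y
    using crossed[OF that] by (rule cong_dvd_iff)
  have unit: "r dvd \<epsilon> x * a \<longleftrightarrow> r dvd a" if "x \<in> carrier G" for x a
    using sign[OF that] by auto
  have cancel: "r dvd f (x \<otimes> y) \<longleftrightarrow> r dvd f y" if "x \<in> carrier G" "y \<in> carrier G" "r dvd f x" for x y
    using iff[OF that(1,2)] that by (simp add: dvd_add_right_iff unit)
  have one: "r dvd f \<one>"
    using crossed[of \<one> \<one>] by (simp add: cong_iff_dvd_diff unit)
  have M: "subgroup ?M G"
  proof (rule subgroupI)
    show "?M \<noteq> {}" using one by blast
    show "inv x \<in> ?M" if "x \<in> ?M" for x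
      using cancel[of x "inv x"] that one by simp
    show "x \<otimes> y \<in> ?M" if "x \<in> ?M" "y \<in> ?M" for x y
      using cancel[of x y] that by simp
  qed auto
  have pow: "[f (u [^] n) = int n] (mod r)" for n :: nat
  proof (induction n)
    case 0
    then show ?case using one by (simp add: cong_0_iff)
  next
    case (Suc n)
    have "u [^] Suc n = u \<otimes> u [^] n" using u(1) by (rule nat_pow_Suc2)
    then have "[f (u [^] Suc n) = f u + f (u [^] n)] (mod r)"
      using crossed[of u "u [^] n"] u by simp
    also have "[f u + f (u [^] n) = 1 + int n] (mod r)" using u(2) Suc by (rule cong_add)
    finally show ?case by simp
  qed
  show ?thesis
  proof (rule maximal_subgroup_if_prime_power_transversal[OF M r u(1)])
    show "u \<notin> ?M"
      using u(2) r by (auto simp: cong_dvd_iff dest: not_prime_unit)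
    have "r = int (nat r)" using prime_ge_0_int[OF r] by simp
    then have "u [^] r = u [^] nat r" by (metis int_pow_int)
    moreover have "r dvd f (u [^] nat r)"
      using pow[of "nat r"] prime_ge_0_int[OF r] by (simp add: cong_dvd_iff)
    ultimately show "u [^] r \<in> ?M" using u(1) by simp
    fix g assume g: "g \<in> carrier G"
    \<comment> \<open>Multiplying g by u^n adds \<epsilon> g * n to the value, and \<epsilon> g squares to 1.\<close>
    define n where "n = nat ((- \<epsilon> g * f g) mod r)"
    have "int n = (- \<epsilon> g * f g) mod r"
      using prime_gt_0_int[OF r] by (simp add: n_def)
    then have n: "[int n = - \<epsilon> g * f g] (mod r)" by (simp add: cong_def)
    have "[f (g \<otimes> u [^] n) = f g + \<epsilon> g * f (u [^] n)] (mod r)" using crossed g u(1) by simp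
    also have "[f g + \<epsilon> g * f (u [^] n) = f g + \<epsilon> g * (- \<epsilon> g * f g)] (mod r)"
      using cong_trans[OF pow n] by (intro cong_add cong_mult cong_refl)
    also have "f g + \<epsilon> g * (- \<epsilon> g * f g) = 0" using sign[OF g] by auto
    finally have "g \<otimes> u [^] n \<in> ?M" using g u(1) by (simp add: cong_0_iff)
    then have "g \<otimes> u [^] int n \<in> ?M" by (simp only: int_pow_int)
    then show "\<exists>j::int. g \<otimes> u [^] j \<in> ?M" by blast
  qed
qed

section \<open>Metabelian groups\<close>

context group
begin

lemma metabelian_iff:
  "metabelian G \<longleftrightarrow> (\<forall>x \<in> derived G (carrier G). \<forall>y \<in> derived G (carrier G). x \<otimes> y = y \<otimes> x)"
proof -
  have "group (G\<lparr>carrier := derived G (carrier G)\<rparr>)"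
    using subgroup_imp_group[OF derived_is_subgroup] by simp
  then show ?thesis
    using is_group group.group_comm_groupI[of "G\<lparr>carrier := derived G (carrier G)\<rparr>"]
      comm_groupE(4)[of "G\<lparr>carrier := derived G (carrier G)\<rparr>"]
    unfolding metabelian_def by auto
qed

lemma metabelian_if_commutators_in:
  assumes B: "subgroup B G" and comm: "\<And>x y. x \<in> B \<Longrightarrow> y \<in> B \<Longrightarrow> x \<otimes> y = y \<otimes> x"
    and "\<And>x y. x \<in> carrier G \<Longrightarrow> y \<in> carrier G \<Longrightarrow> x \<otimes> y \<otimes> inv x \<otimes> inv y \<in> B"
  shows "metabelian G"
proof -
  have "derived G (carrier G) \<subseteq> B"
    unfolding derived_def using assms(3) by (intro generate_subgroup_incl[OF _ B]) auto
  then show ?thesis using comm by (auto simp: metabelian_iff)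
qed

lemma metabelian_imp_solvable:
  assumes "metabelian G"
  shows "solvable G"
proof -
  let ?D = "derived G (carrier G)"
  have "comm_group (G\<lparr>carrier := ?D\<rparr>)" using assms by (simp add: metabelian_def)
  then have "derived (G\<lparr>carrier := ?D\<rparr>) ?D = {\<one>}"
    using comm_group.derived_eq_singleton[of "G\<lparr>carrier := ?D\<rparr>" ?D] by simp
  then have "derived G ?D = {\<one>}" using derived_consistent[OF subset_refl derived_is_subgroup] by simp
  then have "(derived G ^^ 2) (carrier G) = {\<one>}" by (simp add: numeral_2_eq_2)
  then show ?thesis using solvable_iff_trivial_derived_seq by blast
qed

end

section \<open>Transport along isomorphisms\<close>

lemma maximal_subgroup_iso:
  assumes G: "group G" and H: "group H" and h: "h \<in> iso G H" and M: "maximal_subgroup M G"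
  shows "maximal_subgroup (h ` M) H"
proof -
  interpret G: group G by fact
  let ?g = "inv_into (carrier G) h"
  have g: "?g \<in> iso H G" using G.iso_set_sym[OF h] .
  interpret h: group_hom G H h using G H h by (simp add: group_hom_def group_hom_axioms_def iso_def)
  interpret g: group_hom H G ?g using G H g by (simp add: group_hom_def group_hom_axioms_def iso_def)
  have bij: "bij_betw h (carrier G) (carrier H)" using h by (simp add: iso_def)
  have sub: "subgroup M G" "M \<noteq> carrier G" using M by (auto simp: maximal_subgroup_def)
  have "h ` M \<noteq> carrier H"
    using bij sub subgroup.subset[OF sub(1)]
    by (metis bij_betw_def inj_on_image_eq_iff subset_refl)
  moreover have "K = h ` M \<or> K = carrier H" if K: "subgroup K H" "h ` M \<subseteq> K" for K
  proof -
    have hg: "h ` ?g ` K = K"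
      using bij subgroup.subset[OF K(1)] by (metis bij_betw_def image_inv_into_cancel)
    have "M \<subseteq> ?g ` K"
      using K(2) bij subgroup.subset[OF sub(1)]
      by (metis bij_betw_def image_mono inv_into_image_cancel)
    then have "?g ` K = M \<or> ?g ` K = carrier G"
      using M g.subgroup_img_is_subgroup[OF K(1)] by (auto simp: maximal_subgroup_def)
    then show ?thesis using hg bij by (auto simp: bij_betw_def)
  qed
  ultimately show ?thesis
    using h.subgroup_img_is_subgroup[OF sub(1)] by (auto simp: maximal_subgroup_def)
qed

lemma frattini_iso_subset:
  assumes G: "group G" and H: "group H" and h: "h \<in> iso G H"
  shows "h ` frattini G \<subseteq> frattini H"
proof (rule image_subsetI)
  fix x assume x: "x \<in> frattini G"
  let ?g = "inv_into (carrier G) h"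
  have xc: "x \<in> carrier G" using x by (simp add: frattini_def)
  have bij: "bij_betw h (carrier G) (carrier H)" using h by (simp add: iso_def)
  have "h x \<in> M" if M: "maximal_subgroup M H" for M
  proof -
    have "x \<in> ?g ` M"
      using x maximal_subgroup_iso[OF H G group.iso_set_sym[OF G h] M] by (auto simp: frattini_def)
    moreover have "M \<subseteq> carrier H" using M subgroup.subset by (auto simp: maximal_subgroup_def)
    ultimately show ?thesis using bij by (auto simp: bij_betw_def f_inv_into_f subset_iff)
  qed
  then show "h x \<in> frattini H" using xc bij by (auto simp: frattini_def bij_betw_def)
qed

text \<open>The inclusion above, for the isomorphism and for its inverse, gives both inequalities.\<close>

lemma card_frattini_iso:
  assumes G: "group G" and H: "group H" and h: "h \<in> iso G H" and fin: "finite (carrier G)"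
  shows "card (frattini H) = card (frattini G)"
proof -
  have bij: "bij_betw h (carrier G) (carrier H)" using h by (simp add: iso_def)
  have finH: "finite (carrier H)" using bij fin bij_betw_finite by blast
  have sub: "frattini G \<subseteq> carrier G" "frattini H \<subseteq> carrier H" by (auto simp: frattini_def)
  have "card (frattini G) \<le> card (frattini H)"
    using frattini_iso_subset[OF G H h] bij sub finH
    by (intro card_inj_on_le[of h]) (auto simp: bij_betw_def intro: inj_on_subset finite_subset)
  moreover have "card (frattini H) \<le> card (frattini G)"
    using frattini_iso_subset[OF H G group.iso_set_sym[OF G h]] bij_betw_inv_into[OF bij] sub fin
    by (intro card_inj_on_le[of "inv_into (carrier G) h"])
      (auto simp: bij_betw_def intro: inj_on_subset finite_subset)
  ultimately show ?thesis by simp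
qed

lemma metabelian_iso:
  assumes G: "group G" and H: "group H" and h: "h \<in> iso G H" and "metabelian G"
  shows "metabelian H"
proof -
  interpret h: group_hom G H h using G H h by (simp add: group_hom_def group_hom_axioms_def iso_def)
  have img: "derived H (carrier H) = h ` derived G (carrier G)"
    using h.derived_img[of "carrier G"] h by (simp add: iso_def bij_betw_def)
  have sub: "derived G (carrier G) \<subseteq> carrier G" by (rule h.G.derived_in_carrier) simp
  have "h x \<otimes>\<^bsub>H\<^esub> h y = h y \<otimes>\<^bsub>H\<^esub> h x"
    if "x \<in> derived G (carrier G)" "y \<in> derived G (carrier G)" for x y
  proof -
    have "x \<otimes>\<^bsub>G\<^esub> y = y \<otimes>\<^bsub>G\<^esub> x" using assms(4) that by (simp add: h.G.metabelian_iff)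
    then have "h (x \<otimes>\<^bsub>G\<^esub> y) = h (y \<otimes>\<^bsub>G\<^esub> x)" by simp
    then show ?thesis using that sub by (simp add: h.hom_mult subsetD)
  qed
  then show ?thesis by (auto simp: h.H.metabelian_iff img)
qed

lemma finite_group_nat_copy:
  assumes "group G" "finite (carrier G)"
  obtains H :: "nat monoid" and h where "group H" "h \<in> iso G H"
proof -
  interpret group G by fact
  obtain f :: "'a \<Rightarrow> nat" where f: "inj_on f (carrier G)"
    using finite_imp_inj_to_nat_seg[OF assms(2)] by blast
  define H :: "nat monoid" where "H = \<lparr>carrier = f ` carrier G,
    monoid.mult = \<lambda>a b. f (inv_into (carrier G) f a \<otimes>\<^bsub>G\<^esub> inv_into (carrier G) f b), one = f \<one>\<^bsub>G\<^esub>\<rparr>"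
  have iso: "f \<in> iso G H"
    using f by (auto simp: iso_def hom_def bij_betw_def H_def)
  have "group H" using iso_imp_img_group[OF iso] by (simp add: H_def)
  then show thesis using iso by (rule that)
qed

text \<open>The lower bound for an isomorphic copy K: the hypotheses are still about G, where they can be computed in coordinates.\<close>

lemma (in index_two_sylow) least_sysnorms_iso_ge:
  assumes K: "group K" and h: "h \<in> iso G K"
    and centerless: "\<And>x. x \<in> carrier G \<Longrightarrow> (\<And>t. t \<in> involutions G \<Longrightarrow> x \<otimes> t = t \<otimes> x) \<Longrightarrow> x = \<one>"
    and common: "\<And>S. S \<subseteq> involutions G \<Longrightarrow> card S < m \<Longrightarrow>
      \<exists>x \<in> carrier G. x \<noteq> \<one> \<and> (\<forall>t \<in> S. x \<otimes> t = t \<otimes> x)"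
  shows "m \<le> least_sysnorms K"
proof -
  interpret K: group K by fact
  interpret h: group_hom G K h
    using K h is_group by (simp add: group_hom_def group_hom_axioms_def iso_def)
  have inj: "inj_on h (carrier G)" and img: "h ` carrier G = carrier K"
    using h by (auto simp: iso_def bij_betw_def)
  have inv_h: "involutions G \<subseteq> carrier G" by (auto simp: involutions_def)
  have inv_iff: "h t \<in> involutions K \<longleftrightarrow> t \<in> involutions G" if "t \<in> carrier G" for t
    using that inj_on_eq_iff[OF inj that, of \<one>] inj_on_eq_iff[OF inj, of "t \<otimes> t" \<one>]
    by (simp add: involutions_def)
  have comm_iff: "h x \<otimes>\<^bsub>K\<^esub> h y = h y \<otimes>\<^bsub>K\<^esub> h x \<longleftrightarrow> x \<otimes> y = y \<otimes> x"
    if "x \<in> carrier G" "y \<in> carrier G" for x y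
    using that inj_on_eq_iff[OF inj, of "x \<otimes> y" "y \<otimes> x"] by simp
  have PG: "P \<subseteq> carrier G" using subgroup.subset[OF P] .
  interpret K: index_two_sylow K "h ` P" p N
  proof (intro index_two_sylow.intro index_two_sylow_axioms.intro)
    show "group K" by fact
    show "subgroup (h ` P) K" using h.subgroup_img_is_subgroup[OF P] .
    show "card (h ` P) = p ^ N"
      using card_image[OF inj_on_subset[OF inj PG]] card_P by simp
    show "order K = 2 * p ^ N"
      using card_image[OF inj] order_G img by (simp add: order_def)
  qed (use p N in auto)
  show ?thesis
  proof (rule K.least_sysnorms_ge)
    fix y assume y: "y \<in> carrier K" and comm: "\<And>t. t \<in> involutions K \<Longrightarrow> y \<otimes>\<^bsub>K\<^esub> t = t \<otimes>\<^bsub>K\<^esub> y"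
    obtain x where x: "x \<in> carrier G" "y = h x" using y img by blast
    have "x \<otimes> t = t \<otimes> x" if t: "t \<in> involutions G" for t
    proof -
      have tc: "t \<in> carrier G" using t inv_h by blast
      show ?thesis using comm[of "h t"] t inv_iff[OF tc] comm_iff[OF x(1) tc] x(2) by simp
    qed
    then have "x = \<one>" using centerless[OF x(1)] by blast
    then show "y = \<one>\<^bsub>K\<^esub>" using x by simp
  next
    fix S assume S: "S \<subseteq> involutions K" "card S < m"
    let ?T = "{t \<in> carrier G. h t \<in> S}"
    have "h ` ?T = S"
      using S(1) img by (auto simp: involutions_def image_iff subset_iff)
    moreover have "inj_on h ?T" using inj by (rule inj_on_subset) blast
    ultimately have "card ?T < m" using S(2) card_image by fastforce
    moreover have "?T \<subseteq> involutions G" using S(1) inv_iff by blast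
    ultimately obtain x where x: "x \<in> carrier G" "x \<noteq> \<one>" "\<forall>t \<in> ?T. x \<otimes> t = t \<otimes> x"
      using common by blast
    have "h x \<noteq> \<one>\<^bsub>K\<^esub>" using x inj_on_eq_iff[OF inj x(1), of \<one>] by simp
    moreover have "h x \<otimes>\<^bsub>K\<^esub> s = s \<otimes>\<^bsub>K\<^esub> h x" if s: "s \<in> S" for s
    proof -
      obtain t where t: "t \<in> ?T" "s = h t" using s \<open>h ` ?T = S\<close> by blast
      then show ?thesis using x comm_iff[OF x(1), of t] by simp
    qed
    ultimately show "\<exists>x \<in> carrier K. x \<noteq> \<one>\<^bsub>K\<^esub> \<and> (\<forall>t \<in> S. x \<otimes>\<^bsub>K\<^esub> t = t \<otimes>\<^bsub>K\<^esub> x)"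
      using x(1) h.hom_closed by blast
  qed
qed

section \<open>A family of twisted Heisenberg groups\<close>

type_synonym tuple = "int \<times> (nat \<Rightarrow> int) \<times> (nat \<Rightarrow> int) \<times> int"

text \<open>The Frattini subgroup of the group below has order p^k, and m is the rank of its factors C and W. For k = 0 the
quadruples with s = 1 would form the Heisenberg group of order p^(2m+1); enlarging its centre from \<int>/p to
\<int>/p^(k+1) yields Frattini subgroups of order p^k for every k \<ge> 1.\<close>

locale twisted_heisenberg =
  fixes p k m :: nat
  assumes p: "prime p" "odd p" and k: "k > 0"
begin

text \<open>The quadruple (s, c, w, z) stands for the product of (w, z) \<in> W \<oplus> Z and (c, s) \<in> C \<times> {1, -1}.
Taking arbitrary integers as arguments and reducing them here lets all computations be done with integers,
with congruences appearing only in equality tests.\<close>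

definition el :: "int \<Rightarrow> (nat \<Rightarrow> int) \<Rightarrow> (nat \<Rightarrow> int) \<Rightarrow> int \<Rightarrow> tuple" where
  "el s c w z = (s, \<lambda>i\<in>{..<m}. c i mod int p, \<lambda>i\<in>{..<m}. w i mod int p, z mod int p ^ Suc k)"

definition H :: "tuple monoid" where
  "H = \<lparr>carrier = {el s c w z | s c w z. s = 1 \<or> s = -1},
     monoid.mult = \<lambda>(s, c, w, z) (s', c', w', z').
       el (s * s') (\<lambda>i. c i + c' i) (\<lambda>i. w i + s * w' i)
         (z + s * (z' + int p ^ k * (\<Sum>i<m. c i * w' i))),
     one = el 1 (\<lambda>_. 0) (\<lambda>_. 0) 0\<rparr>"

lemma el_eq_iff:
  "el s c w z = el s' c' w' z' \<longleftrightarrow> s = s' \<and> (\<forall>i<m. [c i = c' i] (mod int p)) \<and>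
     (\<forall>i<m. [w i = w' i] (mod int p)) \<and> [z = z'] (mod int p ^ Suc k)"
  by (auto simp: el_def cong_def restrict_def fun_eq_iff)

lemma coordinates:
  "fst (el s c w z) = s"
  "i < m \<Longrightarrow> fst (snd (el s c w z)) i = c i mod int p"
  "i < m \<Longrightarrow> fst (snd (snd (el s c w z))) i = w i mod int p"
  "snd (snd (snd (el s c w z))) = z mod int p ^ Suc k"
  by (simp_all add: el_def)

lemma el_in_carrier [simp]: "el s c w z \<in> carrier H \<longleftrightarrow> s = 1 \<or> s = -1"
proof
  show "el s c w z \<in> carrier H \<Longrightarrow> s = 1 \<or> s = -1" by (auto simp: H_def el_eq_iff)
  show "s = 1 \<or> s = -1 \<Longrightarrow> el s c w z \<in> carrier H" unfolding H_def by auto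
qed

lemma carrierE:
  assumes "x \<in> carrier H"
  obtains s c w z where "x = el s c w z" "s = 1 \<or> s = -1"
  using assms by (auto simp: H_def)

lemma one_el: "\<one>\<^bsub>H\<^esub> = el 1 (\<lambda>_. 0) (\<lambda>_. 0) 0"
  by (simp add: H_def)

text \<open>The product is compatible with reduction because the pairing \<langle>c, w'\<rangle> is determined modulo p and is then
multiplied by p^k, so that the last coordinate is determined modulo p^(k+1).\<close>

lemma el_mult: "el s c w z \<otimes>\<^bsub>H\<^esub> el s' c' w' z' =
  el (s * s') (\<lambda>i. c i + c' i) (\<lambda>i. w i + s * w' i)
    (z + s * (z' + int p ^ k * (\<Sum>i<m. c i * w' i)))"
proof -
  let ?n = "int p ^ Suc k"
  let ?c = "\<lambda>i\<in>{..<m}. c i mod int p" and ?w' = "\<lambda>i\<in>{..<m}. w' i mod int p"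
  have "[(\<Sum>i<m. ?c i * ?w' i) = (\<Sum>i<m. c i * w' i)] (mod int p)"
    by (intro cong_sum cong_mult) (auto simp: cong_def)
  then have "int p ^ k * int p dvd int p ^ k * ((\<Sum>i<m. ?c i * ?w' i) - (\<Sum>i<m. c i * w' i))"
    unfolding cong_iff_dvd_diff by (rule mult_dvd_mono[OF dvd_refl])
  then have sum: "[int p ^ k * (\<Sum>i<m. ?c i * ?w' i) = int p ^ k * (\<Sum>i<m. c i * w' i)] (mod ?n)"
    unfolding cong_iff_dvd_diff right_diff_distrib power_Suc2 .
  have mod: "[a mod ?n = a] (mod ?n)" for a by (simp add: cong_def)
  have "[z mod ?n + s * (z' mod ?n + int p ^ k * (\<Sum>i<m. ?c i * ?w' i)) =
      z + s * (z' + int p ^ k * (\<Sum>i<m. c i * w' i))] (mod ?n)"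
    by (rule cong_add[OF mod cong_mult[OF cong_refl cong_add[OF mod sum]]])
  moreover have "[?c i + (\<lambda>i\<in>{..<m}. c' i mod int p) i = c i + c' i] (mod int p)" if "i < m" for i
    using that by (simp add: cong_def mod_add_eq)
  moreover have "[(\<lambda>i\<in>{..<m}. w i mod int p) i + s * ?w' i = w i + s * w' i] (mod int p)" if "i < m" for i
    using that by (simp, intro cong_add cong_mult) (auto simp: cong_def)
  ultimately have "el (s * s') (\<lambda>i. ?c i + (\<lambda>i\<in>{..<m}. c' i mod int p) i)
      (\<lambda>i. (\<lambda>i\<in>{..<m}. w i mod int p) i + s * ?w' i)
      (z mod ?n + s * (z' mod ?n + int p ^ k * (\<Sum>i<m. ?c i * ?w' i))) =
    el (s * s') (\<lambda>i. c i + c' i) (\<lambda>i. w i + s * w' i)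
      (z + s * (z' + int p ^ k * (\<Sum>i<m. c i * w' i)))"
    unfolding el_eq_iff by blast
  then show ?thesis unfolding H_def by (simp add: el_def)
qed

lemma el_left_inverse:
  assumes "s = 1 \<or> s = -1"
  shows "el s (\<lambda>i. - c i) (\<lambda>i. - s * w i) (s * (int p ^ k * (\<Sum>i<m. c i * w i) - z)) \<otimes>\<^bsub>H\<^esub> el s c w z = \<one>\<^bsub>H\<^esub>"
  using assms by (auto simp: el_mult one_el sum_negf)

lemma group_H: "group H"
proof (rule groupI)
  show "x \<otimes>\<^bsub>H\<^esub> y \<in> carrier H" if "x \<in> carrier H" "y \<in> carrier H" for x y
    using that by (auto simp: el_mult elim!: carrierE)
  show "\<one>\<^bsub>H\<^esub> \<in> carrier H" by (simp add: one_el)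
  show "x \<otimes>\<^bsub>H\<^esub> y \<otimes>\<^bsub>H\<^esub> u = x \<otimes>\<^bsub>H\<^esub> (y \<otimes>\<^bsub>H\<^esub> u)"
    if xyz: "x \<in> carrier H" "y \<in> carrier H" "u \<in> carrier H" for x y u
  proof -
    obtain s1 c1 w1 z1 where x: "x = el s1 c1 w1 z1" using xyz(1) by (rule carrierE)
    obtain s2 c2 w2 z2 where y: "y = el s2 c2 w2 z2" using xyz(2) by (rule carrierE)
    obtain s3 c3 w3 z3 where u: "u = el s3 c3 w3 z3" using xyz(3) by (rule carrierE)
    show ?thesis unfolding x y u el_mult
      by (simp add: algebra_simps sum.distrib sum_distrib_left)
  qed
  show "\<one>\<^bsub>H\<^esub> \<otimes>\<^bsub>H\<^esub> x = x" if "x \<in> carrier H" for x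
    using that by (auto simp: one_el el_mult elim!: carrierE)
  show "\<exists>y\<in>carrier H. y \<otimes>\<^bsub>H\<^esub> x = \<one>\<^bsub>H\<^esub>" if x: "x \<in> carrier H" for x
  proof -
    obtain s c w z where x: "x = el s c w z" "s = 1 \<or> s = -1" using x by (rule carrierE)
    then show ?thesis using el_left_inverse[OF x(2)] el_in_carrier by blast
  qed
qed

sublocale group H by (rule group_H)

lemma el_inv:
  assumes "s = 1 \<or> s = -1"
  shows "inv\<^bsub>H\<^esub> el s c w z =
    el s (\<lambda>i. - c i) (\<lambda>i. - s * w i) (s * (int p ^ k * (\<Sum>i<m. c i * w i) - z))"
  by (rule inv_equality[OF el_left_inverse]) (use assms in auto)

subsection \<open>Order\<close>

lemma p_gt_2: "p > 2"
  using p prime_ge_2_nat[of p] by (cases "p = 2") auto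

abbreviation "cube \<equiv> PiE {..<m} (\<lambda>_. {0..<int p})"

lemma el_range:
  "{el s c w z | s c w z. s \<in> S} = S \<times> cube \<times> cube \<times> {0..<int p ^ Suc k}"
proof -
  have pos: "int p > 0" "int p ^ Suc k > 0" using p_gt_2 by simp_all
  have fixed: "(\<lambda>i\<in>{..<m}. c i mod int p) = c" if "c \<in> cube" for c
  proof
    show "(\<lambda>i\<in>{..<m}. c i mod int p) i = c i" for i
      using that PiE_mem[OF that, of i] PiE_arb[OF that, of i] by (cases "i < m") auto
  qed
  have "x \<in> {el s c w z | s c w z. s \<in> S}" if "x \<in> S \<times> cube \<times> cube \<times> {0..<int p ^ Suc k}" for x
  proof -
    obtain s c w z where x: "x = (s, c, w, z)" by (cases x) auto
    have "x = el s c w z" using that unfolding x el_def by (simp add: fixed)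
    moreover have "s \<in> S" using that x by simp
    ultimately show ?thesis by blast
  qed
  moreover have "el s c w z \<in> S \<times> cube \<times> cube \<times> {0..<int p ^ Suc k}" if "s \<in> S" for s c w z
    using that pos unfolding el_def by (simp add: restrict_PiE_iff)
  ultimately show ?thesis by blast
qed

lemma card_el_range: "card {el s c w z | s c w z. s \<in> S} = card S * p ^ (2 * m + Suc k)"
proof -
  have "card cube = p ^ m" by (simp add: card_PiE)
  moreover have "card {0..<int p ^ Suc k} = p ^ Suc k"
    by (simp add: nat_mult_distrib nat_power_eq)
  ultimately show ?thesis
    unfolding el_range by (simp add: card_cartesian_product power_add mult_2 mult.assoc)
qed

definition P :: "tuple set" where "P = {el 1 c w z | c w z. True}"

lemma el_in_P [simp]: "el 1 c w z \<in> P"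
  unfolding P_def by blast

lemma P_E:
  assumes "x \<in> P"
  obtains c w z where "x = el 1 c w z"
  using assms unfolding P_def by blast

lemma subgroup_P: "subgroup P H"
proof (rule subgroupI)
  show "inv\<^bsub>H\<^esub> x \<in> P" if "x \<in> P" for x
    using that by (auto simp: el_inv elim!: P_E)
  show "x \<otimes>\<^bsub>H\<^esub> y \<in> P" if "x \<in> P" "y \<in> P" for x y
    using that by (auto simp: el_mult elim!: P_E)
  show "P \<noteq> {}" using el_in_P by blast
qed (auto elim: P_E)

lemma order_H: "order H = 2 * p ^ (2 * m + Suc k)"
proof -
  have "carrier H = {el s c w z | s c w z. s \<in> {1, -1}}" by (simp add: H_def)
  then show ?thesis using card_el_range[of "{1, -1}"] by (simp add: order_def)
qed

lemma card_P: "card P = p ^ (2 * m + Suc k)"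
proof -
  have "P = {el s c w z | s c w z. s \<in> {1}}" by (auto simp: P_def)
  then show ?thesis using card_el_range[of "{1}"] by simp
qed

sublocale index_two_sylow H P p "2 * m + Suc k"
  by (intro index_two_sylow.intro index_two_sylow_axioms.intro is_group subgroup_P p card_P order_H) simp

lemma metabelian_H: "metabelian H"
proof (rule metabelian_if_commutators_in)
  \<comment> \<open>The normal subgroup B, that is, the kernel of the projection to T.\<close>
  let ?B = "{el 1 (\<lambda>_. 0) w z | w z. True}"
  have el_in_B: "el 1 (\<lambda>_. 0) w z \<in> ?B" for w z by blast
  show "subgroup ?B H"
  proof (rule subgroupI)
    show "inv\<^bsub>H\<^esub> x \<in> ?B" if x: "x \<in> ?B" for x
    proof -
      obtain w z where "x = el 1 (\<lambda>_. 0) w z" using x by blast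
      then show ?thesis using el_in_B by (simp add: el_inv)
    qed
    show "x \<otimes>\<^bsub>H\<^esub> y \<in> ?B" if xy: "x \<in> ?B" "y \<in> ?B" for x y
    proof -
      obtain w z w' z' where "x = el 1 (\<lambda>_. 0) w z" "y = el 1 (\<lambda>_. 0) w' z'" using xy by blast
      then show ?thesis using el_in_B by (simp add: el_mult)
    qed
    show "?B \<noteq> {}" using el_in_B by blast
    show "?B \<subseteq> carrier H" by auto
  qed
  show "x \<otimes>\<^bsub>H\<^esub> y = y \<otimes>\<^bsub>H\<^esub> x" if "x \<in> ?B" "y \<in> ?B" for x y
    using that by (auto simp: el_mult add.commute)
  show "x \<otimes>\<^bsub>H\<^esub> y \<otimes>\<^bsub>H\<^esub> inv\<^bsub>H\<^esub> x \<otimes>\<^bsub>H\<^esub> inv\<^bsub>H\<^esub> y \<in> ?B" if xy: "x \<in> carrier H" "y \<in> carrier H" for x y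
  proof -
    obtain s c w z where x: "x = el s c w z" "s = 1 \<or> s = -1" using xy(1) by (rule carrierE)
    obtain s' c' w' z' where y: "y = el s' c' w' z'" "s' = 1 \<or> s' = -1" using xy(2) by (rule carrierE)
    have "s * s' * s * s' = 1" using x y by auto
    then show ?thesis using el_in_B
      unfolding x y el_inv[OF x(2)] el_inv[OF y(2)] el_mult by simp
  qed
qed

subsection \<open>The Frattini subgroup\<close>

text \<open>One maximal subgroup for each coordinate. The last one uses k > 0: only then does the term
p^k \<langle>c, w'\<rangle> disappear modulo p, making the last coordinate a crossed homomorphism.\<close>

lemma frattini_coordinates:
  assumes "el s c w z \<in> frattini H"
  shows "s = 1" "\<And>i. i < m \<Longrightarrow> int p dvd c i" "\<And>i. i < m \<Longrightarrow> int p dvd w i" "int p dvd z"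
proof -
  have prime_p: "prime (int p)" using p by simp
  have s: "s = 1 \<or> s = -1" using assms by (simp add: frattini_def)
  let ?e = "\<lambda>i j. if j = i then 1 else 0 :: int"
  have mem: "el s c w z \<in> M" if "maximal_subgroup M H" for M
    using assms that by (auto simp: frattini_def)
  have modp: "[a mod int p = a] (mod int p)" for a by (simp add: cong_def)
  note crossed_hom = maximal_subgroup_crossed_hom
  \<comment> \<open>The sign, written additively modulo 2.\<close>
  have "maximal_subgroup {x \<in> carrier H. 2 dvd (if fst x = 1 then 0 else 1 :: int)} H"
  proof (rule crossed_hom[where \<epsilon> = "\<lambda>_. 1" and u = "el (-1) (\<lambda>_. 0) (\<lambda>_. 0) 0"])
    fix x y assume xy: "x \<in> carrier H" "y \<in> carrier H"
    obtain s c w z where x: "x = el s c w z" "s = 1 \<or> s = -1" using xy(1) by (rule carrierE)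
    obtain s' c' w' z' where y: "y = el s' c' w' z'" "s' = 1 \<or> s' = -1" using xy(2) by (rule carrierE)
    show "[(if fst (x \<otimes>\<^bsub>H\<^esub> y) = 1 then 0 else 1) = (if fst x = 1 then 0 else 1) + 1 * (if fst y = 1 then 0 else 1)] (mod (2 :: int))"
      using x(2) y(2) by (auto simp: x(1) y(1) el_mult coordinates cong_def)
  qed (simp_all add: coordinates)
  from mem[OF this] s show "s = 1" by (auto simp: coordinates split: if_splits)
  show "int p dvd c i" if i: "i < m" for i
  proof -
    have "maximal_subgroup {x \<in> carrier H. int p dvd fst (snd x) i} H"
    proof (rule crossed_hom[where \<epsilon> = "\<lambda>_. 1" and u = "el 1 (?e i) (\<lambda>_. 0) 0", OF prime_p])
      fix x y assume xy: "x \<in> carrier H" "y \<in> carrier H"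
      obtain s c w z where x: "x = el s c w z" using xy(1) by (rule carrierE)
      obtain s' c' w' z' where y: "y = el s' c' w' z'" using xy(2) by (rule carrierE)
      show "[fst (snd (x \<otimes>\<^bsub>H\<^esub> y)) i = fst (snd x) i + 1 * fst (snd y) i] (mod int p)"
        using i by (simp add: x y el_mult coordinates cong_def mod_add_eq)
    qed (use i in \<open>simp_all add: coordinates cong_def\<close>)
    from mem[OF this] i show ?thesis by (simp add: coordinates dvd_mod_iff)
  qed
  show "int p dvd w i" if i: "i < m" for i
  proof -
    have "maximal_subgroup {x \<in> carrier H. int p dvd fst (snd (snd x)) i} H"
    proof (rule crossed_hom[where \<epsilon> = fst and u = "el 1 (\<lambda>_. 0) (?e i) 0", OF prime_p])
      fix x y assume xy: "x \<in> carrier H" "y \<in> carrier H"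
      obtain s c w z where x: "x = el s c w z" using xy(1) by (rule carrierE)
      obtain s' c' w' z' where y: "y = el s' c' w' z'" using xy(2) by (rule carrierE)
      show "[fst (snd (snd (x \<otimes>\<^bsub>H\<^esub> y))) i = fst (snd (snd x)) i + fst x * fst (snd (snd y)) i] (mod int p)"
        unfolding x y el_mult coordinates(1) coordinates(3)[OF i]
        by (rule cong_trans[OF modp cong_sym[OF cong_add[OF modp cong_mult[OF cong_refl modp]]]])
    qed (use i in \<open>auto simp: coordinates cong_def elim!: carrierE\<close>)
    from mem[OF this] i show ?thesis by (simp add: coordinates dvd_mod_iff)
  qed
  have red: "[a mod int p ^ Suc k = a] (mod int p)" for a
    by (simp add: cong_def mod_mod_cancel)
  have qk: "int p dvd int p ^ k" using k by simp
  have "maximal_subgroup {x \<in> carrier H. int p dvd snd (snd (snd x))} H"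
  proof (rule maximal_subgroup_crossed_hom[where \<epsilon> = fst and u = "el 1 (\<lambda>_. 0) (\<lambda>_. 0) 1", OF prime_p])
    fix x y assume xy: "x \<in> carrier H" "y \<in> carrier H"
    obtain s c w z where x: "x = el s c w z" using xy(1) by (rule carrierE)
    obtain s' c' w' z' where y: "y = el s' c' w' z'" using xy(2) by (rule carrierE)
    have "[z + s * (z' + int p ^ k * (\<Sum>i<m. c i * w' i)) = z + s * (z' + 0)] (mod int p)"
      using qk by (intro cong_add cong_mult cong_refl) (simp add: cong_0_iff)
    also have "[z + s * (z' + 0) = z mod int p ^ Suc k + s * (z' mod int p ^ Suc k)] (mod int p)"
      using red[THEN cong_sym] by (simp del: power_Suc, intro cong_add cong_mult cong_refl)
    finally show "[snd (snd (snd (x \<otimes>\<^bsub>H\<^esub> y))) = snd (snd (snd x)) + fst x * snd (snd (snd y))] (mod int p)"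
      unfolding x y el_mult using cong_trans[OF red] by (simp add: coordinates del: power_Suc)
  qed (auto simp: coordinates red simp del: power_Suc elim!: carrierE)
  from mem[OF this] have "int p dvd z mod int p ^ Suc k" by (simp add: coordinates)
  then show "int p dvd z" using red[of z] by (simp add: cong_dvd_iff)
qed

text \<open>The subgroup Z, with generator \<zeta> = zeta 1.\<close>

abbreviation "zeta a \<equiv> el 1 (\<lambda>_. 0) (\<lambda>_. 0) a"

lemma zeta_int_pow: "zeta a [^]\<^bsub>H\<^esub> (j::int) = zeta (a * j)"
proof -
  have nat: "zeta b [^]\<^bsub>H\<^esub> n = zeta (b * int n)" for b and n :: nat
    by (induction n) (simp_all add: one_el el_mult algebra_simps)
  show ?thesis
  proof (cases j rule: int_cases2)
    case (nonneg n)
    then show ?thesis by (simp add: int_pow_int nat)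
  next
    case (nonpos n)
    then show ?thesis by (simp add: int_pow_neg int_pow_int nat el_inv)
  qed
qed

lemma frattini_H: "frattini H = {zeta (int p * j) | j. True}"
proof
  show "frattini H \<subseteq> {zeta (int p * j) | j. True}"
  proof
    fix x assume x: "x \<in> frattini H"
    then have "x \<in> carrier H" by (simp add: frattini_def)
    then obtain s c w z where xe: "x = el s c w z" by (rule carrierE)
    note co = frattini_coordinates[OF x[unfolded xe]]
    obtain j where "z = int p * j" using co(4) by (auto simp: dvd_def)
    then have "x = zeta (int p * j)" using co by (simp add: xe el_eq_iff cong_0_iff)
    then show "x \<in> {zeta (int p * j) | j. True}" by blast
  qed
  show "{zeta (int p * j) | j. True} \<subseteq> frattini H"
  proof (rule normal_subset_frattini[where y = "zeta 1" and r = "int p" and e = "Suc k"])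
    show "{zeta (int p * j) | j. True} \<lhd> H"
    proof (rule normal_invI)
      show "subgroup {zeta (int p * j) | j. True} H"
      proof (rule subgroupI)
        show "inv\<^bsub>H\<^esub> x \<in> {zeta (int p * j) | j. True}" if x: "x \<in> {zeta (int p * j) | j. True}" for x
        proof -
          obtain j where "x = zeta (int p * j)" using x by blast
          then have "inv\<^bsub>H\<^esub> x = zeta (int p * (- j))" by (simp add: el_inv)
          then show ?thesis by blast
        qed
        show "x \<otimes>\<^bsub>H\<^esub> y \<in> {zeta (int p * j) | j. True}"
          if xy: "x \<in> {zeta (int p * j) | j. True}" "y \<in> {zeta (int p * j) | j. True}" for x y
        proof -
          obtain i j where "x = zeta (int p * i)" "y = zeta (int p * j)" using xy by blast
          then have "x \<otimes>\<^bsub>H\<^esub> y = zeta (int p * (i + j))" by (simp add: el_mult distrib_left)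
          then show ?thesis by blast
        qed
        show "{zeta (int p * j) | j. True} \<noteq> {}" by blast
        show "{zeta (int p * j) | j. True} \<subseteq> carrier H" by auto
      qed
      fix x h assume x: "x \<in> carrier H" and h: "h \<in> {zeta (int p * j) | j. True}"
      obtain s c w z where xe: "x = el s c w z" "s = 1 \<or> s = -1" using x by (rule carrierE)
      obtain j where h: "h = zeta (int p * j)" using h by blast
      have "x \<otimes>\<^bsub>H\<^esub> h = zeta (int p * (s * j)) \<otimes>\<^bsub>H\<^esub> x"
        by (simp add: xe h el_mult algebra_simps)
      then have "x \<otimes>\<^bsub>H\<^esub> h \<otimes>\<^bsub>H\<^esub> inv\<^bsub>H\<^esub> x = zeta (int p * (s * j))"
        using x by (simp add: m_assoc)
      then show "x \<otimes>\<^bsub>H\<^esub> h \<otimes>\<^bsub>H\<^esub> inv\<^bsub>H\<^esub> x \<in> {zeta (int p * j) | j. True}" by blast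
    qed
    show "zeta 1 [^]\<^bsub>H\<^esub> (int p ^ Suc k) = \<one>\<^bsub>H\<^esub>"
      by (simp add: zeta_int_pow one_el el_eq_iff cong_0_iff del: power_Suc)
  qed (auto simp: zeta_int_pow)
qed

lemma card_frattini_H: "card (frattini H) = p ^ k"
proof -
  have pos: "int p > 0" using p_gt_2 by simp
  have eq: "zeta (int p * i) = zeta (int p * j) \<longleftrightarrow> [i = j] (mod int p ^ k)" for i j
    using pos by (simp add: el_eq_iff cong_iff_dvd_diff flip: right_diff_distrib)
  have "frattini H = (\<lambda>j. zeta (int p * j)) ` {0..<int p ^ k}"
  proof -
    have "zeta (int p * j) = zeta (int p * (j mod int p ^ k))" for j
      by (simp add: eq cong_def)
    moreover have "j mod int p ^ k \<in> {0..<int p ^ k}" for j using pos by simp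
    ultimately show ?thesis unfolding frattini_H by blast
  qed
  moreover have "inj_on (\<lambda>j. zeta (int p * j)) {0..<int p ^ k}"
    by (intro inj_onI) (auto simp: eq cong_def)
  ultimately show ?thesis by (simp add: card_image nat_power_eq)
qed

subsection \<open>Involutions\<close>

text \<open>Since p is odd, an element of B that equals its own inverse is trivial.\<close>

lemma dvd_two_times: "int p ^ n dvd 2 * a \<longleftrightarrow> int p ^ n dvd a"
proof -
  have "coprime (int p ^ n) 2" using p by (simp add: coprime_commute)
  then show ?thesis by (simp add: coprime_dvd_mult_right_iff)
qed

lemma p_dvd_two_times: "int p dvd 2 * a \<longleftrightarrow> int p dvd a"
  using dvd_two_times[of 1 a] by simp

lemma involution_el: "el (-1) (\<lambda>_. 0) w z \<in> involutions H"
  by (simp add: involutions_def one_el el_mult el_eq_iff)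

lemma involutionE:
  assumes "t \<in> involutions H"
  obtains w z where "t = el (-1) (\<lambda>_. 0) w z"
proof -
  have t: "t \<in> carrier H" "t \<noteq> \<one>\<^bsub>H\<^esub>" "t \<otimes>\<^bsub>H\<^esub> t = \<one>\<^bsub>H\<^esub>"
    using assms by (auto simp: involutions_def)
  obtain s c w z where te: "t = el s c w z" "s = 1 \<or> s = -1" using t(1) by (rule carrierE)
  have sq: "\<And>i. i < m \<Longrightarrow> int p dvd 2 * c i" "\<And>i. i < m \<Longrightarrow> int p dvd w i + s * w i"
    "int p ^ Suc k dvd z + s * (z + int p ^ k * (\<Sum>i<m. c i * w i))"
    using t(3) unfolding te el_mult one_el el_eq_iff cong_0_iff by auto
  have c: "int p dvd c i" if "i < m" for i using sq(1)[OF that] by (simp only: p_dvd_two_times)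
  have "s = -1"
  proof (rule ccontr)
    assume "s \<noteq> -1"
    then have s: "s = 1" using te by simp
    have w: "int p dvd w i" if "i < m" for i
    proof -
      have "w i + s * w i = 2 * w i" using s by simp
      then show ?thesis using sq(2)[OF that] by (simp only: p_dvd_two_times)
    qed
    have "int p dvd (\<Sum>i<m. c i * w i)" using c by (intro dvd_sum dvd_mult2) simp
    then have "int p ^ Suc k dvd int p ^ k * (\<Sum>i<m. c i * w i)"
      unfolding power_Suc2 by (rule mult_dvd_mono[OF dvd_refl])
    moreover have "z + s * (z + int p ^ k * (\<Sum>i<m. c i * w i)) = 2 * z + int p ^ k * (\<Sum>i<m. c i * w i)"
      using s by simp
    ultimately have "int p ^ Suc k dvd 2 * z" using sq(3) by (metis dvd_add_left_iff)
    then have "int p ^ Suc k dvd z" by (simp only: dvd_two_times)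
    then have "t = \<one>\<^bsub>H\<^esub>" using c w s by (simp add: te one_el el_eq_iff cong_0_iff)
    then show False using t(2) by simp
  qed
  then have "t = el (-1) (\<lambda>_. 0) w z" using c by (simp add: te el_eq_iff cong_0_iff)
  then show thesis using that by blast
qed

text \<open>Testing against w' = 0 with z' = 0 and z' = 1 determines w, z and the sign; the unit vectors w' then
read off the entries of c.\<close>

lemma centralizer_involutions_trivial:
  assumes x: "x \<in> carrier H" and comm: "\<And>t. t \<in> involutions H \<Longrightarrow> x \<otimes>\<^bsub>H\<^esub> t = t \<otimes>\<^bsub>H\<^esub> x"
  shows "x = \<one>\<^bsub>H\<^esub>"
proof -
  let ?n = "int p ^ Suc k"
  obtain s c w z where xe: "x = el s c w z" "s = 1 \<or> s = -1" using x by (rule carrierE)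
  have eq: "(\<forall>i<m. int p dvd w i + s * w' i - (w' i - w i)) \<and>
      ?n dvd z + s * (z' + int p ^ k * (\<Sum>i<m. c i * w' i)) - (z' - z)" for w' z'
    using comm[OF involution_el[of w' z']]
    unfolding xe el_mult el_eq_iff cong_iff_dvd_diff by simp
  have w: "int p dvd w i" if "i < m" for i
  proof -
    have "int p dvd w i + s * 0 - (0 - w i)" using eq[of "\<lambda>_. 0" 0] that by blast
    moreover have "w i + s * 0 - (0 - w i) = 2 * w i" by simp
    ultimately show ?thesis by (simp only: p_dvd_two_times)
  qed
  have z: "?n dvd z"
  proof -
    have "?n dvd z + s * (0 + int p ^ k * (\<Sum>i<m. c i * 0)) - (0 - z)"
      using eq[of "\<lambda>_. 0" 0] by blast
    moreover have "z + s * (0 + int p ^ k * (\<Sum>i<m. c i * 0)) - (0 - z) = 2 * z" by simp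
    ultimately show ?thesis by (simp only: dvd_two_times)
  qed
  have s: "s = 1"
  proof (rule ccontr)
    assume "s \<noteq> 1"
    then have "s = -1" using xe(2) by simp
    then have "?n dvd z + - 1 * 1 - (1 - z)" using eq[of "\<lambda>_. 0" 1] by (simp del: power_Suc)
    moreover have "z + - 1 * 1 - (1 - z) = 2 * (z - 1)" by simp
    ultimately have "?n dvd z - 1" by (simp only: dvd_two_times)
    then have "?n dvd z - (z - 1)" by (rule dvd_diff[OF z])
    moreover have "int p dvd ?n" by simp
    moreover have "z - (z - 1) = 1" by simp
    ultimately have "int p dvd 1" by (metis dvd_trans)
    then show False using p_gt_2 by simp
  qed
  have c: "int p dvd c i" if "i < m" for i
  proof -
    let ?e = "\<lambda>j. if j = i then 1 else 0 :: int"
    have "(\<Sum>j<m. c j * ?e j) = (\<Sum>j<m. if j = i then c j else 0)"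
      by (rule sum.cong) auto
    then have delta: "(\<Sum>j<m. c j * ?e j) = c i" using that by simp
    have "?n dvd z + s * (0 + int p ^ k * (\<Sum>j<m. c j * ?e j)) - (0 - z)"
      using eq[of ?e 0] by blast
    moreover have "z + s * (0 + int p ^ k * (\<Sum>j<m. c j * ?e j)) - (0 - z) = 2 * z + int p ^ k * c i"
      unfolding delta s by simp
    ultimately have "?n dvd 2 * z + int p ^ k * c i" by (simp only:)
    then have "?n dvd int p ^ k * c i"
      using dvd_add_right_iff[OF dvd_mult[OF z]] by blast
    then show ?thesis using p_gt_2 by simp
  qed
  show ?thesis using s c w z by (simp add: xe one_el el_eq_iff cong_0_iff)
qed

text \<open>An element c \<in> C commutes with the involution with coordinates w and z if \<langle>c, w\<rangle> = 0 modulo p. There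
are p^m vectors c, but fewer tuples of pairings with the elements of S, so two
vectors have the same pairings, and their difference is a nonzero solution.\<close>

lemma common_centralizer:
  assumes S: "S \<subseteq> involutions H" "card S < m"
  shows "\<exists>x \<in> carrier H. x \<noteq> \<one>\<^bsub>H\<^esub> \<and> (\<forall>t \<in> S. x \<otimes>\<^bsub>H\<^esub> t = t \<otimes>\<^bsub>H\<^esub> x)"
proof -
  have finS: "finite S" using S(1) finite_carrier by (auto simp: involutions_def intro: finite_subset)
  have "\<forall>t \<in> S. \<exists>w z. t = el (-1) (\<lambda>_. 0) w z" using S(1) involutionE by (meson subsetD)
  then obtain w z where t: "\<And>t. t \<in> S \<Longrightarrow> t = el (-1) (\<lambda>_. 0) (w t) (z t)" by metis
  let ?pair = "\<lambda>c. \<lambda>t\<in>S. (\<Sum>i<m. c i * w t i) mod int p"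
  let ?values = "PiE S (\<lambda>_. {0..<int p})"
  have "?pair ` cube \<subseteq> ?values" using p_gt_2 by (auto simp: PiE_def)
  then have "card (?pair ` cube) \<le> card ?values"
    using finS by (intro card_mono finite_PiE) auto
  also have "\<dots> < card cube" using S(2) finS p_gt_2 by (simp add: card_PiE)
  finally have "\<not> inj_on ?pair cube" using card_image by fastforce
  then obtain c c' where cc: "c \<in> cube" "c' \<in> cube" "c \<noteq> c'" "?pair c = ?pair c'"
    by (auto simp: inj_on_def)
  let ?x = "el 1 (\<lambda>i. c i - c' i) (\<lambda>_. 0) 0"
  have "?x \<noteq> \<one>\<^bsub>H\<^esub>"
  proof
    assume "?x = \<one>\<^bsub>H\<^esub>"
    then have "[c i = c' i] (mod int p)" if "i < m" for i
      using that by (simp add: one_el el_eq_iff cong_iff_dvd_diff)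
    then have "c i = c' i" if "i < m" for i
      using that PiE_mem[OF cc(1), of i] PiE_mem[OF cc(2), of i]
      by (auto intro!: cong_less_imp_eq_int)
    then have "c = c'" by (intro PiE_ext[OF cc(1,2)]) simp
    then show False using cc(3) by simp
  qed
  moreover have "?x \<otimes>\<^bsub>H\<^esub> t = t \<otimes>\<^bsub>H\<^esub> ?x" if "t \<in> S" for t
  proof -
    have "int p dvd (\<Sum>i<m. (c i - c' i) * w t i)"
      using fun_cong[OF cc(4), of t] that
      by (simp add: mod_eq_dvd_iff sum_subtractf left_diff_distrib)
    then have "?x \<otimes>\<^bsub>H\<^esub> el (-1) (\<lambda>_. 0) (w t) (z t) = el (-1) (\<lambda>_. 0) (w t) (z t) \<otimes>\<^bsub>H\<^esub> ?x"
      by (simp add: el_mult el_eq_iff cong_iff_dvd_diff)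
    then show ?thesis using t[OF that] by simp
  qed
  ultimately show ?thesis using el_in_carrier by blast
qed

end

section \<open>Unboundedness\<close>

lemma exists_metabelian_group:
  assumes "odd (q::nat)" "primepow q"
  obtains G :: "nat monoid"
  where "group G" "finite (carrier G)" "metabelian G" "card (frattini G) = q" "m \<le> least_sysnorms G"
proof -
  obtain p k where pk: "prime p" "k > 0" "q = p ^ k"
    using assms(2) by (auto simp: primepow_def)
  interpret twisted_heisenberg p k m
    using pk assms(1) by unfold_locales auto
  obtain K :: "nat monoid" and h where K: "group K" "h \<in> iso H K"
    using finite_group_nat_copy[OF group_H finite_carrier] .
  have "finite (carrier K)"
    using K(2) finite_carrier bij_betw_finite by (auto simp: iso_def)
  moreover have "metabelian K" using metabelian_iso[OF group_H K metabelian_H] .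
  moreover have "card (frattini K) = q"
    using card_frattini_iso[OF group_H K finite_carrier] card_frattini_H pk by simp
  moreover have "m \<le> least_sysnorms K"
    using least_sysnorms_iso_ge[OF K centralizer_involutions_trivial common_centralizer] by blast
  ultimately show thesis using that K(1) by blast
qed

theorem corollary1p1:
  shows "(\<forall>q::nat. odd q \<and> primepow q \<longrightarrow>
            \<not> (\<exists>n::int. \<forall>G::nat monoid.
                 group G \<and> finite (carrier G) \<and> metabelian G \<and> card (frattini G) = q
                   \<longrightarrow> int (least_sysnorms G) \<le> n)) \<and>
         \<not> (\<exists>n::int. \<forall>G::nat monoid.
              group G \<and> finite (carrier G) \<and> solvable G \<longrightarrow> int (least_sysnorms G) \<le> n) \<and>
         \<not> (\<exists>F::nat \<Rightarrow> nat. (\<forall>m\<ge>1. F m \<ge> 1) \<and>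
              (\<forall>G::nat monoid. group G \<and> finite (carrier G) \<and> solvable G
                 \<longrightarrow> least_sysnorms G \<le> F (card (frattini G))))"
proof (intro conjI allI impI notI)
  fix q :: nat
  assume q: "odd q \<and> primepow q"
  assume "\<exists>n::int. \<forall>G::nat monoid.
    group G \<and> finite (carrier G) \<and> metabelian G \<and> card (frattini G) = q \<longrightarrow> int (least_sysnorms G) \<le> n"
  then obtain n :: int where n: "\<And>G::nat monoid. group G \<Longrightarrow> finite (carrier G) \<Longrightarrow> metabelian G \<Longrightarrow>
      card (frattini G) = q \<Longrightarrow> int (least_sysnorms G) \<le> n" by blast
  obtain G :: "nat monoid" where G: "group G" "finite (carrier G)" "metabelian G"
      "card (frattini G) = q" "Suc (nat n) \<le> least_sysnorms G"
    using exists_metabelian_group[of q "Suc (nat n)"] q by blast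
  then show False using n[OF G(1-4)] by linarith
next
  assume "\<exists>n::int. \<forall>G::nat monoid. group G \<and> finite (carrier G) \<and> solvable G \<longrightarrow> int (least_sysnorms G) \<le> n"
  then obtain n :: int where n: "\<And>G::nat monoid. group G \<Longrightarrow> finite (carrier G) \<Longrightarrow> solvable G \<Longrightarrow>
      int (least_sysnorms G) \<le> n" by blast
  obtain G :: "nat monoid" where G: "group G" "finite (carrier G)" "metabelian G"
      "Suc (nat n) \<le> least_sysnorms G"
    using exists_metabelian_group[of 3 "Suc (nat n)"] by auto
  then show False using n[OF G(1,2) group.metabelian_imp_solvable[OF G(1,3)]] by linarith
next
  assume "\<exists>F::nat \<Rightarrow> nat. (\<forall>m\<ge>1. F m \<ge> 1) \<and> (\<forall>G::nat monoid. group G \<and> finite (carrier G) \<and> solvable G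
    \<longrightarrow> least_sysnorms G \<le> F (card (frattini G)))"
  then obtain F :: "nat \<Rightarrow> nat" where F: "\<And>G::nat monoid. group G \<Longrightarrow> finite (carrier G) \<Longrightarrow> solvable G \<Longrightarrow>
      least_sysnorms G \<le> F (card (frattini G))" by blast
  obtain G :: "nat monoid" where G: "group G" "finite (carrier G)" "metabelian G"
      "card (frattini G) = 3" "Suc (F 3) \<le> least_sysnorms G"
    using exists_metabelian_group[of 3 "Suc (F 3)"] by auto
  then show False using F[OF G(1,2) group.metabelian_imp_solvable[OF G(1,3)]] by simp
qed

end
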